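(* Let $p$ be an odd prime with $p\equiv 3 \pmod 4$, $n$ an odd positive integer, $q=p^n$, $N=\frac{p^n-1}{2}$, $\alpha$ a primitive element of $\mathbb{F}_q$, $\beta\in\mathbb{F}_q^*$, and $m(t)={\rm Tr}_1^n(\beta\alpha^t)$. Let $d=4$ and $$S=\{\,m(2t+i)+m(d(t+l)+j)\;:\;0\le i,j\le 1,\ 0\le l\le N-1\,\}.$$ For $i_1,i_2,j_1,j_2\in\{0,1\}$ and $l_1,l_2,\tau\in\{0,\dots,N-1\}$, the correlation $C(\tau)$ between the sequences $m(2t+i_1)+m(d(t+l_1)+j_1)$ and $m(2t+i_2)+m(d(t+l_2)+j_2)$ of $S$ is $$C(\tau)=\sum_{t=0}^{N-1}\omega^{{\rm Tr}_1^n(a\alpha^{2t}+b\alpha^{4t})},\qquad a=\beta(\alpha^{i_1}-\alpha^{2\tau+i_2}),\quad b=\beta(\alpha^{dl_1+j_1}-\alpha^{d\tau+dl_2+j_2}),$$ and, over all such choices of parameters except the trivial autocorrelation case ($\tau=0$, $i_1=i_2$, $j_1=j_2$, $l_1=l_2$), the maximum magnitude $C_{\rm max}$ of $C(\tau)$ satisfies $$C_{\rm max}\le \frac{3}{\sqrt{2}}\sqrt{N+\frac12}+\frac12 .$$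
   Context: Here ${\rm Tr}_1^n(x)=\sum_{k=0}^{n-1}x^{p^k}$ is the trace function from $\mathbb{F}_q$ to $\mathbb{F}_p$, and $\omega=e^{2\pi\sqrt{-1}/p}$. The sequence $m(t)$ is a $p$-ary m-sequence of period $q-1$; an element of $S$ is a $p$-ary sequence indexed by $t$ (for fixed $i,j,l$), with $s(t+N)=s(t)$ for all $t$. For two $p$-ary sequences $s_1,s_2$ of period $N$, their correlation at shift $\tau$ is $C_{s_1,s_2}(\tau)=\sum_{t=0}^{N-1}\omega^{s_1(t)-s_2(t+\tau)}$. *)

theory Defs
  imports Complex_Main "HOL-Computational_Algebra.Primes" "HOL-Number_Theory.Cong"
begin

(* The trace from F_(p^n) to F_p.  F_p is not a separate type: it is the prime subfield
   of 'a, so traces and p-ary sequences are 'a-valued. *)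
definition field_trace :: "nat \<Rightarrow> nat \<Rightarrow> 'a::finite_field \<Rightarrow> 'a" where
  "field_trace p n x = (\<Sum>k<n. x ^ (p ^ k))"

definition primitive_element :: "'a::finite_field \<Rightarrow> bool" where
  "primitive_element g \<longleftrightarrow> g \<noteq> 0 \<and> (\<forall>x. x \<noteq> 0 \<longrightarrow> (\<exists>k::nat. x = g ^ k))"

(* The representative in {0,...,p-1} of an element of the prime subfield, in characteristic p;
   unspecified outside the prime subfield. *)
definition residue_rep :: "nat \<Rightarrow> 'a::finite_field \<Rightarrow> nat" where
  "residue_rep p x = (THE r. r < p \<and> of_nat r = x)"

(* omega^x for x in F_p, where omega = exp(2 pi i / p) *)
definition omega_pow :: "nat \<Rightarrow> 'a::finite_field \<Rightarrow> complex" where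
  "omega_pow p x = exp (2 * of_real pi * \<i> / of_nat p) ^ residue_rep p x"

definition correlation ::
    "nat \<Rightarrow> nat \<Rightarrow> (nat \<Rightarrow> 'a::finite_field) \<Rightarrow> (nat \<Rightarrow> 'a) \<Rightarrow> nat \<Rightarrow> complex" where
  "correlation p N s1 s2 \<tau> = (\<Sum>t<N. omega_pow p (s1 t - s2 (t + \<tau>)))"

end

theory Submission
  imports Defs "HOL-Algebra.Algebraic_Closure_Type" "HOL-Number_Theory.Residues"
begin

text \<open>
  With \<open>x = \<alpha>\<^sup>t\<close>, twice the correlation is the full exponential sum of \<open>a x\<^sup>2 + b x\<^sup>4\<close> over \<open>F\<^sub>q\<close> without
  its term at \<open>0\<close>, so everything follows from the Weil bound \<open>3 \<surd>q\<close>. For \<open>b = 0\<close> one uses that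
  fourth powers and squares coincide as \<open>q = 3 (mod 4)\<close>.

  For the Weil bound, embed \<open>F\<^sub>q\<close> in its algebraic closure. By the Stepanov-Bombieri method on
  the curve \<open>y\<^sup>p = y + f(x)\<close>, the sum over the extension with \<open>Q\<close> elements (an even power of \<open>p\<close>) is
  \<open>O(\<surd>Q)\<close>. The L-function of the sum, whose coefficients are character sums over monic polynomials, is a
  polynomial of degree at most \<open>3\<close>, so the sum over the extension of degree \<open>k\<close> is
  \<open>-(x\<^sup>k + y\<^sup>k + z\<^sup>k)\<close> for fixed complex \<open>x, y, z\<close>. Letting \<open>k\<close> grow, all three have modulus at
  most \<open>\<surd>q\<close>.
\<close>

text \<open>These constants of HOL-Algebra would shadow the ones for type-class polynomials and primes.\<close>
hide_const (open) Divisibility.prime Coset.order Polynomials.degree Polynomials.lead_coeff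

section \<open>Frobenius, trace and additive character\<close>

text \<open>Growing extension degrees remove it, so all extensions must be at hand together; as
  fixed-point sets of Frobenius powers in one closed field they share a type. Stepanov's
  construction needs \<open>Q\<close> to be a square, hence only even degrees are estimated and the
  final root estimate is made for squares. Geometry is avoided: pole orders at infinity become
  weights of monomials, distinct because \<open>p\<close> and \<open>degree f\<close> are coprime.
  The number 3 is \<open>degree f - 1\<close>: from degree 4 on, a coefficient that enters the
  fourth power sum linearly can be varied freely. Finally, \<open>q = 3 (mod 4)\<close> makes
  \<open>N\<close> odd, so doubling permutes the residues modulo \<open>N\<close>; this settles
  \<open>b = 0\<close> and shows that \<open>a = b = 0\<close> happens only in the trivial
  case.\<close>

lemma proots_prod_linear:
  fixes A :: "'k::idom multiset"
  shows "proots (\<Prod>x\<in>#A. [:-x, 1:]) = A"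
proof (induction A)
  case (add x A)
  have "(\<Prod>x\<in>#A. [:-x, 1:]) \<noteq> 0" by (auto simp: prod_mset_zero_iff)
  then show ?case using add by (simp add: proots_mult del: mult_pCons_left)
qed simp

lemma size_proots_alg_closed:
  fixes g :: "'k::alg_closed_field poly"
  shows "size (proots g) = degree g"
proof (cases "g = 0")
  case False
  then obtain A where A: "size A = degree g" "g = smult (lead_coeff g) (\<Prod>x\<in>#A. [:-x, 1:])"
    using alg_closed_imp_factorization by blast
  have "proots g = proots (\<Prod>x\<in>#A. [:-x, 1:])"
    by (subst A(2)) (use False in simp)
  also have "\<dots> = A"
    by (rule proots_prod_linear)
  finally show ?thesis using A(1) by simp
qed simp

lemma monic_eq_prod_proots:
  fixes g :: "'k::alg_closed_field poly"
  assumes "lead_coeff g = 1"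
  shows "g = (\<Prod>x\<in>#proots g. [:-x, 1:])"
proof -
  have "g \<noteq> 0" using assms by auto
  then obtain A where A: "size A = degree g" "g = smult (lead_coeff g) (\<Prod>x\<in>#A. [:-x, 1:])"
    using alg_closed_imp_factorization by blast
  have g: "g = (\<Prod>x\<in>#A. [:-x, 1:])" using A(2) assms by simp
  have "proots g = A"
    by (subst g) (rule proots_prod_linear)
  with g show ?thesis by simp
qed

lemma proots_subset_imp_dvd:
  fixes g h :: "'k::alg_closed_field poly"
  assumes "lead_coeff g = 1" "lead_coeff h = 1" "proots g \<subseteq># proots h"
  shows "g dvd h"
proof -
  have "h = (\<Prod>x\<in>#proots g + (proots h - proots g). [:-x, 1:])"
    using monic_eq_prod_proots[OF assms(2)] assms(3) by (simp add: subset_mset.add_diff_inverse)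
  also have "\<dots> = g * (\<Prod>x\<in>#proots h - proots g. [:-x, 1:])"
    using monic_eq_prod_proots[OF assms(1)] by simp
  finally show ?thesis by (rule dvdI)
qed

text \<open>Gaussian elimination: an equation with a nonzero coefficient is solved for its pivot
  unknown \<open>v\<close> and substituted into the others (\<open>B\<close>); an equation without
  one is vacuous.\<close>

lemma underdetermined_system_nontrivial:
  fixes A :: "'e \<Rightarrow> 'u \<Rightarrow> 'k::field"
  assumes "finite E" "finite U" "card E < card U"
  shows "\<exists>c. (\<exists>u\<in>U. c u \<noteq> 0) \<and> (\<forall>e\<in>E. (\<Sum>u\<in>U. A e u * c u) = 0)"
  using assms
proof (induction E arbitrary: U A rule: finite_induct)
  case empty
  then have "U \<noteq> {}" by auto
  then show ?case by (intro exI[of _ "\<lambda>_. 1"]) auto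
next
  case (insert e E)
  show ?case
  proof (cases "\<forall>u\<in>U. A e u = 0")
    case True
    have "card E < card U" using insert by simp
    with insert.IH[OF insert.prems(1), of A] obtain c where
      "\<exists>u\<in>U. c u \<noteq> 0" "\<forall>e\<in>E. (\<Sum>u\<in>U. A e u * c u) = 0" by auto
    with True show ?thesis by (intro exI[of _ c]) auto
  next
    case False
    then obtain v where v: "v \<in> U" "A e v \<noteq> 0" by auto
    define B where "B = (\<lambda>e' u. A e' u - A e' v / A e v * A e u)"
    have "card E < card (U - {v})" using insert v by (auto simp: card_Diff_singleton)
    then obtain c where c: "\<exists>u\<in>U - {v}. c u \<noteq> 0"
      "\<forall>e\<in>E. (\<Sum>u\<in>U - {v}. B e u * c u) = 0"
      using insert.IH[of "U - {v}" B] insert.prems(1) by auto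
    define s where "s = (\<Sum>u\<in>U - {v}. A e u * c u)"
    define c' where "c' = c(v := - s / A e v)"
    have split: "(\<Sum>u\<in>U. A e' u * c' u) = A e' v * (- s / A e v) + (\<Sum>u\<in>U - {v}. A e' u * c u)" for e'
    proof -
      have "(\<Sum>u\<in>U. A e' u * c' u) = A e' v * c' v + (\<Sum>u\<in>U - {v}. A e' u * c' u)"
        using insert.prems(1) v(1) by (rule sum.remove)
      also have "(\<Sum>u\<in>U - {v}. A e' u * c' u) = (\<Sum>u\<in>U - {v}. A e' u * c u)"
        by (intro sum.cong) (auto simp: c'_def)
      finally show ?thesis by (simp add: c'_def)
    qed
    have "(\<Sum>u\<in>U. A e u * c' u) = 0"
      unfolding split using v by (simp add: s_def)
    moreover have "(\<Sum>u\<in>U. A e' u * c' u) = 0" if "e' \<in> E" for e'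
    proof -
      have "0 = (\<Sum>u\<in>U - {v}. B e' u * c u)" using c that by simp
      also have "\<dots> = (\<Sum>u\<in>U - {v}. A e' u * c u) - A e' v / A e v * s"
        by (simp add: B_def s_def algebra_simps sum_subtractf sum_distrib_left)
      finally show ?thesis unfolding split by simp
    qed
    moreover have "\<exists>u\<in>U. c' u \<noteq> 0" using c(1) by (auto simp: c'_def)
    ultimately show ?thesis by blast
  qed
qed

text \<open>For \<open>m = p ^ e\<close> with \<open>e > 0\<close>, in a closed field of
  characteristic \<open>p\<close>, this is the subfield with \<open>m\<close> elements. A set rather
  than a type lets \<open>e\<close> vary.\<close>

definition fixed_pts :: "nat \<Rightarrow> 'k::field set" where
  "fixed_pts m = {x. x ^ m = x}"

definition abs_trace :: "nat \<Rightarrow> nat \<Rightarrow> 'k::field \<Rightarrow> 'k" where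
  "abs_trace p e z = (\<Sum>i<e. z ^ p ^ i)"

text \<open>Additive on the prime subfield only. Elsewhere the exponent is an unspecified natural
  number, so the modulus is still 1.\<close>

definition prime_char :: "nat \<Rightarrow> 'k::field \<Rightarrow> complex" where
  "prime_char p z = exp (2 * of_real pi * \<i> / of_nat p) ^ (THE r. r < p \<and> of_nat r = z)"

locale closed_field_char =
  fixes p :: nat and TYP :: "'k::alg_closed_field itself"
  assumes char_p: "CHAR('k) = p" and prime_p: "prime p"
begin

abbreviation Fix :: "nat \<Rightarrow> 'k set" where "Fix \<equiv> fixed_pts"
abbreviation Tr :: "nat \<Rightarrow> 'k \<Rightarrow> 'k" where "Tr \<equiv> abs_trace p"
abbreviation chi :: "'k \<Rightarrow> complex" where "chi \<equiv> prime_char p"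

lemma p_gt_1: "p > 1" using prime_p by (rule prime_gt_1_nat)
lemma p_gt_0: "p > 0" using p_gt_1 by simp

lemma frob_add: "(x + y :: 'k) ^ p ^ k = x ^ p ^ k + y ^ p ^ k"
  using freshmans_dream'[where 'a = 'k, of "p ^ k" k] char_p prime_p by simp

lemma frob_sum: "(sum f A :: 'k) ^ p ^ k = (\<Sum>i\<in>A. f i ^ p ^ k)"
  using freshmans_dream_sum'[where 'a = 'k, of "p ^ k" k] char_p prime_p by simp

lemma frob_diff: "(x - y :: 'k) ^ p ^ k = x ^ p ^ k - y ^ p ^ k"
  using frob_add[of "x - y" y k] by (simp add: algebra_simps)

lemma frob_minus: "(- y :: 'k) ^ p ^ k = - (y ^ p ^ k)"
  using frob_diff[of 0 y k] p_gt_0 by (simp add: zero_power)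

lemma frob_inj: "(x :: 'k) ^ p ^ k = y ^ p ^ k \<Longrightarrow> x = y"
  using frob_diff[of x y k] by (simp add: p_gt_0)

lemma of_nat_eq_iff: "i < p \<Longrightarrow> j < p \<Longrightarrow> (of_nat i :: 'k) = of_nat j \<longleftrightarrow> i = j"
  using of_nat_eq_iff_cong_CHAR[where 'a = 'k, of i j] char_p by (simp add: cong_def)

lemma of_nat_frob: "(of_nat i :: 'k) ^ p = of_nat i"
proof (induction i)
  case (Suc i)
  have "(of_nat (Suc i) :: 'k) ^ p = (of_nat i + 1) ^ p ^ 1" by (simp add: add.commute)
  also have "\<dots> = of_nat i ^ p ^ 1 + 1 ^ p ^ 1" by (rule frob_add)
  finally show ?case using Suc by simp
qed (simp add: p_gt_0)

lemma Fix_finite: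
  assumes "m > 1" shows "finite (Fix m)" "card (Fix m) \<le> m"
proof -
  define g where "g = (monom 1 m - monom 1 1 :: 'k poly)"
  have c: "coeff g m = 1" using assms by (simp add: g_def)
  then have g0: "g \<noteq> 0" by auto
  have "degree g \<le> m" unfolding g_def
    by (rule degree_diff_le) (use assms in \<open>auto intro: order_trans[OF degree_monom_le]\<close>)
  moreover have "Fix m = {x. poly g x = 0}"
    by (auto simp: fixed_pts_def g_def poly_monom)
  ultimately show "finite (Fix m)" "card (Fix m) \<le> m"
    using poly_roots_finite[OF g0] card_poly_roots_bound[OF g0] by auto
qed

text \<open>The derivative of \<open>X\<^sup>m - X\<close> is \<open>-1\<close> in characteristic \<open>p\<close>, so all roots are simple.\<close>
lemma card_Fix:
  assumes "e > 0" shows "card (Fix (p ^ e)) = p ^ e"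
proof -
  define m where "m = p ^ e"
  have m1: "m > 1" unfolding m_def by (rule one_less_power[OF p_gt_1 assms])
  define g where "g = (monom 1 m - monom 1 1 :: 'k poly)"
  have c: "coeff g m = 1" using m1 by (simp add: g_def)
  then have g0: "g \<noteq> 0" by auto
  have "of_nat m = (0 :: 'k)" using char_p assms by (simp add: m_def of_nat_eq_0_iff_char_dvd)
  then have pd: "pderiv g = -1"
    by (simp add: g_def pderiv_diff pderiv_monom)
  have ord: "order x g \<le> 1" for x
  proof (rule ccontr)
    assume "\<not> order x g \<le> 1"
    then have "[:-x, 1:] ^ 2 dvd g" by (simp add: order_divides)
    then obtain h where "g = [:-x, 1:] ^ 2 * h" by (elim dvdE)
    then have "g = [:-x, 1:] * ([:-x, 1:] * h)" by (simp only: power2_eq_square mult.assoc)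
    then have "pderiv g = [:-x, 1:] * pderiv ([:-x, 1:] * h) + [:-x, 1:] * h * pderiv [:-x, 1:]"
      by (simp only: pderiv_mult)
    then have "poly (pderiv g) x = 0" by (simp del: mult_pCons_left)
    with pd show False by simp
  qed
  have "degree g \<ge> m" using c by (intro le_degree) simp
  then have "m \<le> size (proots g)" by (simp add: size_proots_alg_closed)
  also have "\<dots> = (\<Sum>x\<in>set_mset (proots g). order x g)"
    unfolding size_multiset_overloaded_eq using g0 by simp
  also have "\<dots> \<le> (\<Sum>x\<in>set_mset (proots g). 1)" by (intro sum_mono ord)
  also have "\<dots> = card {x. poly g x = 0}" using g0 by simp
  also have "{x. poly g x = 0} = Fix m"
    by (auto simp: fixed_pts_def g_def poly_monom)
  finally show ?thesis using Fix_finite[OF m1] by (simp add: m_def)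
qed

lemma Fix_prime: "Fix p = of_nat ` {..<p}"
proof -
  have "of_nat ` {..<p} \<subseteq> Fix p" by (auto simp: fixed_pts_def of_nat_frob)
  moreover have "card (of_nat ` {..<p} :: 'k set) = p"
    by (subst card_image) (auto simp: inj_on_def of_nat_eq_iff)
  ultimately show ?thesis
    using Fix_finite[OF p_gt_1] by (metis card_seteq)
qed

lemma prime_char_of_nat: "chi (of_nat i) = exp (2 * of_real pi * \<i> / of_nat p) ^ i"
proof -
  define w where "w = exp (2 * of_real pi * \<i> / of_nat p)"
  have "w ^ p = exp (of_nat p * (2 * of_real pi * \<i> / of_nat p))"
    unfolding w_def by (rule exp_of_nat_mult[symmetric])
  also have "of_nat p * (2 * of_real pi * \<i> / of_nat p) = 2 * of_real pi * \<i>"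
    using p_gt_0 by simp
  finally have wp: "w ^ p = 1" by (simp add: exp_two_pi_i)
  have "of_nat (i mod p) = (of_nat i :: 'k)"
    using of_nat_eq_iff_cong_CHAR[where 'a = 'k, of "i mod p" i] char_p by (simp add: cong_def)
  then have "(THE r. r < p \<and> of_nat r = (of_nat i :: 'k)) = i mod p"
    using p_gt_0 of_nat_eq_iff[of _ "i mod p"] by (intro the_equality) auto
  then have "chi (of_nat i) = w ^ (i mod p)" by (simp add: prime_char_def w_def)
  also have "\<dots> = w ^ (p * (i div p) + i mod p)"
    unfolding power_add power_mult wp by simp
  finally show ?thesis by (simp add: w_def)
qed

lemma chi_0 [simp]: "chi 0 = 1"
  using prime_char_of_nat[of 0] by simp

lemma chi_add: "x \<in> Fix p \<Longrightarrow> y \<in> Fix p \<Longrightarrow> chi (x + y) = chi x * chi y"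
  by (auto simp: Fix_prime prime_char_of_nat power_add simp flip: of_nat_add)

lemma norm_chi: "cmod (chi x) = 1"
  by (simp add: prime_char_def norm_power)

lemma chi_eq_1_iff: "x \<in> Fix p \<Longrightarrow> chi x = 1 \<longleftrightarrow> x = 0"
proof -
  assume "x \<in> Fix p"
  then obtain i where i: "i < p" "x = of_nat i" by (auto simp: Fix_prime)
  have "i = 0" if "chi x = 1"
  proof -
    have "cis (2 * pi * real i / real p) = chi x"
      by (simp add: i prime_char_of_nat cis_conv_exp flip: exp_of_nat_mult) (simp add: mult_ac)
    then have "cos (2 * pi * real i / real p) = 1" using that by (simp add: complex_eq_iff)
    then obtain m :: int where "2 * pi * real i / real p = of_int m * 2 * pi"
      unfolding cos_one_2pi_int by blast
    then have "real i = of_int m * real p" using p_gt_0 by (simp add: field_simps)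
    then have "int i = m * int p" by (metis of_int_eq_iff of_int_mult of_int_of_nat_eq)
    then have "p dvd i" by (metis dvd_triv_right int_dvd_int_iff)
    then show ?thesis using i by (auto dest: dvd_imp_le)
  qed
  then show ?thesis using i by auto
qed

lemma Fix_power:
  assumes "x \<in> Fix m" shows "x ^ m ^ k = x"
  using assms by (induction k) (auto simp: fixed_pts_def power_mult)

section \<open>The absolute trace\<close>

lemma Tr_add: "Tr e (x + y) = Tr e x + Tr e y"
  by (simp add: abs_trace_def frob_add sum.distrib)

lemma Tr_diff: "Tr e (x - y) = Tr e x - Tr e y"
  by (simp add: abs_trace_def frob_diff sum_subtractf)

lemma Tr_frob: "Tr e x ^ p + x = Tr e x + x ^ p ^ e"
proof -
  have "Tr e x ^ p + x = (\<Sum>i<e. x ^ p ^ Suc i) + x ^ p ^ 0"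
    unfolding abs_trace_def using frob_sum[of _ "{..<e}" 1] by (simp add: mult.commute flip: power_mult)
  also have "\<dots> = (\<Sum>i<Suc e. x ^ p ^ i)" by (subst sum.lessThan_Suc_shift) (simp add: add.commute)
  finally show ?thesis by (simp add: abs_trace_def)
qed

lemma Tr_in_Fix: "x \<in> Fix (p ^ e) \<Longrightarrow> Tr e x \<in> Fix p"
  using Tr_frob[of e x] by (simp add: fixed_pts_def)

text \<open>The trace is a nonzero polynomial of degree at most \<open>p ^ (e - 1)\<close>, too
  small to vanish at \<open>p ^ e\<close> points.\<close>

lemma Tr_nonzero_exists:
  assumes "e > 0" obtains x where "x \<in> Fix (p ^ e)" "Tr e x \<noteq> 0"
proof (rule ccontr)
  assume "\<not> thesis"
  then have z: "Fix (p ^ e) \<subseteq> {x. Tr e x = 0}" using that by blast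
  define g where "g = (\<Sum>i<e. monom 1 (p ^ i) :: 'k poly)"
  have "coeff g (p ^ (e - 1)) = (\<Sum>i<e. if i = e - 1 then 1 else 0)"
    unfolding g_def coeff_sum using p_gt_1 by (intro sum.cong) (auto simp: )
  then have "coeff g (p ^ (e - 1)) = 1" using assms by simp
  then have g0: "g \<noteq> 0" by auto
  have dg: "degree g \<le> p ^ (e - 1)" unfolding g_def
  proof (intro degree_sum_le)
    fix i assume "i \<in> {..<e}"
    then have "p ^ i \<le> p ^ (e - 1)" using p_gt_0 by (intro power_increasing) auto
    then show "degree (monom 1 (p ^ i) :: 'k poly) \<le> p ^ (e - 1)"
      using degree_monom_le order_trans by blast
  qed simp
  have "{x. Tr e x = 0} = {x. poly g x = 0}"
    by (simp add: g_def abs_trace_def poly_sum poly_monom)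
  then have "p ^ e \<le> p ^ (e - 1)"
    using card_mono[OF poly_roots_finite[OF g0], of "Fix (p ^ e)"] z card_poly_roots_bound[OF g0] dg
    by (simp add: card_Fix[OF assms])
  moreover have "p ^ (e - 1) < p ^ e" using assms p_gt_1 by (intro power_strict_increasing) auto
  ultimately show False by simp
qed

end

section \<open>Weights on Artin-Schreier curves\<close>

text \<open>On the curve \<open>y\<^sup>p = y + f(x)\<close>, the function \<open>\<phi>\<close> has pole order less than \<open>D\<close> at infinity, where
  \<open>x\<close> and \<open>y\<close> have the pole orders \<open>p\<close> and \<open>degree f\<close>.\<close>
definition below :: "nat \<Rightarrow> 'k::field poly \<Rightarrow> nat \<Rightarrow> ('k \<Rightarrow> 'k \<Rightarrow> 'k) \<Rightarrow> bool" where
  "below p f D \<phi> \<longleftrightarrow> (\<exists>g.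
     (\<forall>i j. coeff (g j) i \<noteq> 0 \<longrightarrow> j < p \<and> p * i + degree f * j < D) \<and>
     (\<forall>x y. y ^ p = y + poly f x \<longrightarrow> \<phi> x y = (\<Sum>j<p. poly (g j) x * y ^ j)))"

lemma below_cong:
  assumes "below p f D \<phi>" "\<And>x y. y ^ p = y + poly f x \<Longrightarrow> \<psi> x y = \<phi> x y"
  shows "below p f D \<psi>"
proof -
  obtain g where "\<forall>i j. coeff (g j) i \<noteq> 0 \<longrightarrow> j < p \<and> p * i + degree f * j < D"
      "\<forall>x y. y ^ p = y + poly f x \<longrightarrow> \<phi> x y = (\<Sum>j<p. poly (g j) x * y ^ j)"
    using assms(1) unfolding below_def by blast
  with assms(2) show ?thesis unfolding below_def by (intro exI[of _ g]) simp
qed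

lemma below_mono: "below p f D \<phi> \<Longrightarrow> D \<le> D' \<Longrightarrow> below p f D' \<phi>"
  unfolding below_def by (meson order_less_le_trans)

lemma below_zero: "below p f D (\<lambda>x y. 0)"
  unfolding below_def by (intro exI[of _ "\<lambda>_. 0"]) simp

lemma below_add:
  assumes "below p f D \<phi>" "below p f D \<psi>"
  shows "below p f D (\<lambda>x y. \<phi> x y + \<psi> x y)"
proof -
  obtain g where g: "\<And>i j. coeff (g j) i \<noteq> 0 \<Longrightarrow> j < p \<and> p * i + degree f * j < D"
      "\<And>x y. y ^ p = y + poly f x \<Longrightarrow> \<phi> x y = (\<Sum>j<p. poly (g j) x * y ^ j)"
    using assms(1) unfolding below_def by blast
  obtain h where h: "\<And>i j. coeff (h j) i \<noteq> 0 \<Longrightarrow> j < p \<and> p * i + degree f * j < D"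
      "\<And>x y. y ^ p = y + poly f x \<Longrightarrow> \<psi> x y = (\<Sum>j<p. poly (h j) x * y ^ j)"
    using assms(2) unfolding below_def by blast
  have "j < p \<and> p * i + degree f * j < D" if "coeff (g j + h j) i \<noteq> 0" for i j
    using g(1)[of j i] h(1)[of j i] that by (cases "coeff (g j) i = 0") auto
  then show ?thesis
    unfolding below_def
    by (intro exI[of _ "\<lambda>j. g j + h j"]) (auto simp: g(2) h(2) distrib_right sum.distrib)
qed

lemma below_smult:
  assumes "below p f D \<phi>"
  shows "below p f D (\<lambda>x y. c * \<phi> x y)"
proof -
  obtain g where g: "\<And>i j. coeff (g j) i \<noteq> 0 \<Longrightarrow> j < p \<and> p * i + degree f * j < D"
      "\<And>x y. y ^ p = y + poly f x \<Longrightarrow> \<phi> x y = (\<Sum>j<p. poly (g j) x * y ^ j)"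
    using assms(1) unfolding below_def by blast
  have "j < p \<and> p * i + degree f * j < D" if "coeff (smult c (g j)) i \<noteq> 0" for i j
    using g(1)[of j i] that by auto
  then show ?thesis
    unfolding below_def
    by (intro exI[of _ "\<lambda>j. smult c (g j)"]) (auto simp: g(2) sum_distrib_left mult.assoc)
qed

lemma below_sum:
  assumes "\<And>i. i \<in> I \<Longrightarrow> below p f D (\<phi> i)"
  shows "below p f D (\<lambda>x y. \<Sum>i\<in>I. \<phi> i x y)"
  using assms
  by (induction I rule: infinite_finite_induct) (auto intro: below_zero below_add)

lemma below_reduced_monomial:
  assumes "b < p" "p * a + degree f * b < D"
  shows "below p f D (\<lambda>x y. x ^ a * y ^ b)"
proof -
  have "(\<Sum>j<p. poly (if j = b then monom 1 a else 0) x * y ^ j) = x ^ a * y ^ b" for x y :: 'a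
  proof -
    have "(\<Sum>j<p. poly (if j = b then monom 1 a else 0) x * y ^ j) =
        (\<Sum>j<p. if j = b then x ^ a * y ^ b else 0)"
      by (intro sum.cong) (auto simp: poly_monom)
    then show ?thesis using assms(1) by simp
  qed
  then show ?thesis
    unfolding below_def using assms
    by (intro exI[of _ "\<lambda>j. if j = b then monom 1 a else 0"]) (auto split: if_splits)
qed

text \<open>Trading \<open>y ^ p\<close> for \<open>x ^ h\<close> preserves the weight, as both
  weigh \<open>p * h\<close>.\<close>

lemma weight_reduce:
  "p * (a + h * (b div p)) + h * (b mod p) = p * a + h * (b :: nat)"
proof -
  have "h * b = h * (p * (b div p) + b mod p)" by (simp only: mult_div_mod_eq)
  also have "\<dots> = p * (h * (b div p)) + h * (b mod p)"
    by (simp only: distrib_left mult.left_commute)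
  finally show ?thesis by (simp add: distrib_left)
qed

text \<open>Modulo smaller weight, the relation \<open>y\<^sup>p = y + f(x)\<close> reads \<open>y\<^sup>p = lead_coeff f * x ^ degree f\<close>.\<close>
lemma below_monomial_leading:
  fixes f :: "'k::field poly"
  assumes p: "p > 1" and f: "degree f > 0"
  shows "below p f (p * a + degree f * b)
    (\<lambda>x y. x ^ a * y ^ b - lead_coeff f ^ (b div p) * (x ^ (a + degree f * (b div p)) * y ^ (b mod p)))"
proof (induction b arbitrary: a rule: less_induct)
  case (less b)
  show ?case
  proof (cases "b < p")
    case True
    then show ?thesis by (simp add: below_zero)
  next
    case False
    define h where "h = degree f"
    define b' where "b' = b - p"
    have b: "b = b' + p" and b': "b' < b" "b' + 1 < b" using False p by (auto simp: b'_def)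
    have mono: "below p f D (\<lambda>x y. x ^ a * y ^ b)" if "b < b' + p" "p * a + degree f * b < D" for a b D
    proof -
      have "below p f D (\<lambda>x y. (x ^ a * y ^ b - lead_coeff f ^ (b div p) *
            (x ^ (a + degree f * (b div p)) * y ^ (b mod p))) +
            lead_coeff f ^ (b div p) * (x ^ (a + degree f * (b div p)) * y ^ (b mod p)))"
        using that p less[of b a] b
        by (intro below_add below_smult below_reduced_monomial)
          (auto simp: weight_reduce intro: below_mono)
      then show ?thesis by (simp add: algebra_simps)
    qed
    have w: "p * (a + h) + h * b' = p * a + degree f * b" by (simp add: b h_def algebra_simps)
    \<comment> \<open>One use of the relation turns \<open>y ^ b\<close> into
      \<open>y ^ b' * (y + f(x))\<close>. Only the leading term of \<open>f\<close> keeps the full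
      weight: the summand \<open>y\<close> loses weight since \<open>p > 1\<close>, the lower terms
      of \<open>f\<close> by their smaller degree.\<close>
    have "below p f (p * a + degree f * b)
      (\<lambda>x y. (lead_coeff f * (x ^ (a + h) * y ^ b' -
          lead_coeff f ^ (b' div p) * (x ^ ((a + h) + h * (b' div p)) * y ^ (b' mod p)))
        + x ^ a * y ^ (b' + 1)) + (\<Sum>i<h. coeff f i * (x ^ (a + i) * y ^ b')))"
    proof (intro below_add below_sum below_smult mono)
      show "below p f (p * a + degree f * b) (\<lambda>x y. x ^ (a + h) * y ^ b' -
          lead_coeff f ^ (b' div p) * (x ^ ((a + h) + h * (b' div p)) * y ^ (b' mod p)))"
        using less[OF b'(1), of "a + h"] w by (simp add: h_def)
      show "b' + 1 < b' + p" "b' < b' + p" using p by auto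
      show "p * a + degree f * (b' + 1) < p * a + degree f * b" using b' f mult_less_mono2[OF b'(2) f] by simp
      fix i assume "i \<in> {..<h}"
      then show "p * (a + i) + degree f * b' < p * a + degree f * b"
        using p by (simp add: b h_def algebra_simps)
    qed
    then show ?thesis
    proof (rule below_cong)
      fix x y :: 'k
      assume y: "y ^ p = y + poly f x"
      have "poly f x = lead_coeff f * x ^ h + (\<Sum>i<h. coeff f i * x ^ i)"
        by (simp add: poly_altdef h_def lessThan_Suc_atMost[symmetric])
      then have "x ^ a * y ^ b = x ^ a * y ^ b' * (y + (lead_coeff f * x ^ h + (\<Sum>i<h. coeff f i * x ^ i)))"
        using y by (simp add: b power_add)
      also have "\<dots> = lead_coeff f * (x ^ (a + h) * y ^ b') + x ^ a * y ^ (b' + 1) +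
          (\<Sum>i<h. coeff f i * (x ^ (a + i) * y ^ b'))"
        by (simp add: algebra_simps power_add sum_distrib_left sum_distrib_right)
      finally have e: "x ^ a * y ^ b = lead_coeff f * (x ^ (a + h) * y ^ b') + x ^ a * y ^ (b' + 1) +
          (\<Sum>i<h. coeff f i * (x ^ (a + i) * y ^ b'))" .
      have d: "b div p = Suc (b' div p)" "b mod p = b' mod p" using p by (auto simp: b)
      show "x ^ a * y ^ b - lead_coeff f ^ (b div p) * (x ^ (a + degree f * (b div p)) * y ^ (b mod p)) =
        lead_coeff f * (x ^ (a + h) * y ^ b' -
          lead_coeff f ^ (b' div p) * (x ^ ((a + h) + h * (b' div p)) * y ^ (b' mod p)))
        + x ^ a * y ^ (b' + 1) + (\<Sum>i<h. coeff f i * (x ^ (a + i) * y ^ b'))"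
        unfolding e d by (simp add: algebra_simps h_def)
    qed
  qed
qed

lemma below_monomial:
  fixes f :: "'k::field poly"
  assumes "p > 1" "degree f > 0" "p * a + degree f * b < D"
  shows "below p f D (\<lambda>x y. x ^ a * y ^ b)"
proof -
  have "below p f D (\<lambda>x y. (x ^ a * y ^ b - lead_coeff f ^ (b div p) *
        (x ^ (a + degree f * (b div p)) * y ^ (b mod p))) +
        lead_coeff f ^ (b div p) * (x ^ (a + degree f * (b div p)) * y ^ (b mod p)))"
    using assms by (intro below_add below_smult below_reduced_monomial below_mono[OF below_monomial_leading])
      (auto simp: weight_reduce)
  then show ?thesis by simp
qed

section \<open>Counting reduced monomials by weight\<close>

definition small_exps :: "nat \<Rightarrow> nat \<Rightarrow> nat \<Rightarrow> (nat \<times> nat) set" where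
  "small_exps p h D = {(a, b). b < p \<and> p * a + h * b < D}"

lemma finite_small_exps: "p > 0 \<Longrightarrow> finite (small_exps p h D)"
proof (rule finite_subset)
  assume "p > 0"
  then show "small_exps p h D \<subseteq> {..<D} \<times> {..<p}"
  proof (clarsimp simp: small_exps_def)
    fix a b assume *: "p * a + h * b < D"
    have "1 * a \<le> p * a" using \<open>p > 0\<close> by (intro mult_right_mono) auto
    with * show "a < D" by linarith
  qed
qed simp

text \<open>Modulo \<open>p\<close> the weight is \<open>h * b\<close> with \<open>h\<close>
  invertible, which recovers \<open>b\<close> and then \<open>a\<close>.\<close>

lemma inj_on_weight:
  assumes "coprime p (h::nat)" "b < p" "b' < p" "p * a + h * b = p * a' + h * b'"
  shows "a = a' \<and> b = b'"
proof -
  have "(p * a + h * b) mod p = (p * a' + h * b') mod p" using assms by simp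
  then have "[h * b = h * b'] (mod p)" by (simp add: cong_def)
  then have "[b = b'] (mod p)" using assms(1) cong_mult_lcancel_nat[of h p] by (simp add: coprime_commute)
  then have "b = b'" using assms by (simp add: cong_def)
  then show ?thesis using assms by simp
qed

text \<open>Distinct weights below \<open>D\<close> give the upper bound. For the lower one, each
  \<open>v\<close> from \<open>p * h\<close> up to \<open>D\<close> is attained: take
  \<open>b < p\<close> with \<open>h * b\<close> congruent to \<open>v\<close> modulo
  \<open>p\<close>; then \<open>h * b\<close> is at most \<open>v\<close>. This is an elementary
  substitute for a Riemann-Roch count.\<close>

lemma card_small_exps:
  assumes "coprime p (h::nat)" "p > 0"
  shows "card (small_exps p h D) \<le> D" "D - p * h \<le> card (small_exps p h D)"
proof -
  define w where "w = (\<lambda>(a, b). p * a + h * b)"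
  have inj: "inj_on w (small_exps p h D)"
    using inj_on_weight[OF assms(1)] by (auto simp: inj_on_def w_def small_exps_def)
  have sub: "w ` small_exps p h D \<subseteq> {..<D}"
    by (auto simp: w_def small_exps_def)
  show "card (small_exps p h D) \<le> D"
    using card_mono[OF _ sub] card_image[OF inj] by simp
  have "{p * h..<D} \<subseteq> w ` small_exps p h D"
  proof
    fix v assume v: "v \<in> {p * h..<D}"
    obtain z where z: "[h * z = 1] (mod p)"
      using cong_solve_coprime_nat[of h p] assms(1) by (auto simp: coprime_commute)
    define b where "b = (z * v) mod p"
    have bp: "b < p" using assms by (simp add: b_def)
    have "[h * b = h * z * v] (mod p)" by (simp add: b_def cong_def mod_mult_right_eq mult.assoc)
    also have "[h * z * v = 1 * v] (mod p)" by (intro cong_mult z) simp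
    finally have c: "[h * b = v] (mod p)" by simp
    have le: "h * b \<le> v"
    proof -
      have "h * b \<le> h * p" using bp by simp
      also have "\<dots> \<le> v" using v by (simp add: mult.commute)
      finally show ?thesis .
    qed
    have "p dvd v - h * b" using c le cong_altdef_nat[of "h * b" v p] cong_sym_eq[of "h * b" v p] by (metis cong_altdef_nat)
    then obtain a where "v - h * b = p * a" by (elim dvdE)
    then have "v = w (a, b)" using le by (simp add: w_def)
    moreover have "(a, b) \<in> small_exps p h D" using v bp \<open>v = w (a, b)\<close> by (auto simp: small_exps_def w_def)
    ultimately show "v \<in> w ` small_exps p h D" by blast
  qed
  then have "card {p * h..<D} \<le> card (w ` small_exps p h D)"
    using finite_small_exps[OF assms(2)] by (intro card_mono) auto
  then show "D - p * h \<le> card (small_exps p h D)" by (simp add: card_image[OF inj])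
qed

section \<open>The Stepanov-Bombieri bound\<close>

context closed_field_char
begin

lemma Fix_finite_power: "e > 0 \<Longrightarrow> finite (Fix (p ^ e))"
  by (intro Fix_finite one_less_power p_gt_1)

text \<open>The relation telescopes under iterated Frobenius. Hence \<open>y\<close> is fixed by the
  \<open>e\<close>-th iterate precisely when the trace of \<open>z\<close> vanishes.\<close>

lemma artin_schreier_frob:
  assumes "y ^ p = y + z" shows "y ^ p ^ e = y + Tr e z"
proof (induction e)
  case (Suc e)
  have "y ^ p ^ Suc e = (y ^ p) ^ p ^ e" by (simp flip: power_mult)
  also have "\<dots> = y ^ p ^ e + z ^ p ^ e" by (simp add: assms frob_add)
  finally show ?case using Suc by (simp add: abs_trace_def algebra_simps)
qed (simp add: abs_trace_def)

lemma artin_schreier_root: "\<exists>y::'k. y ^ p = y + z"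
proof -
  define g where "g = monom 1 p - monom 1 1 - [:z:]"
  have "coeff g p = 1" using p_gt_1 by (simp add: g_def coeff_pCons split: nat.split)
  then have "p \<le> degree g" by (intro le_degree) simp
  then have "degree g > 0" using p_gt_0 by simp
  then obtain y where "poly g y = 0" using alg_closed_imp_poly_has_root by blast
  then have "y ^ p = y + z" by (simp add: g_def poly_monom algebra_simps)
  then show ?thesis ..
qed

text \<open>Write \<open>Q = P * P\<close>. A linear system gives coefficients \<open>c\<close>, not all \<open>0\<close>, such that \<open>F = \<Sum> c\<^bsub>s,t\<^esub> s\<^sup>P t\<close>, over monomials \<open>s, t\<close> of
  bounded weight, vanishes on the curve. On points over the field with \<open>Q\<close> elements it equals the \<open>P\<close>-th power
  of \<open>G = \<Sum> d\<^bsub>s,t\<^esub> s t\<^sup>P\<close>, where \<open>d\<^sup>P = c\<close>. So \<open>G\<close> vanishes there, whereas \<open>G \<noteq> 0\<close> on the curve because its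
  monomials have distinct weights.\<close>
lemma stepanov_card_bound:
  fixes f :: "'k poly"
  assumes cop: "coprime p (degree f)" and f0: "degree f > 0"
    and P: "P = p ^ s" and c: "c = p * degree f" and big: "c * c + 3 * c + 1 < P"
    and Z: "Z \<subseteq> Fix (p ^ (2 * s))" and tr: "\<And>x. x \<in> Z \<Longrightarrow> Tr (2 * s) (poly f x) = 0"
  shows "p * card Z \<le> P * P + (2 * c + 1) * P"
proof -
  define h where "h = degree f"
  define Q where "Q = P * P"
  have Q: "Q = p ^ (2 * s)" by (simp add: Q_def P mult_2 power_add)
  define w where "w = (\<lambda>(a, b). p * a + h * b :: nat)"
  define S where "S = small_exps p h P"
  \<comment> \<open>The excess \<open>2 * c + 1\<close> makes \<open>card S * card T\<close> at
    least \<open>(P - c) * (P + c + 1) = P * P + P - c * c - c\<close>, which exceeds the bound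
    \<open>D = P * P + 2 * c + 1\<close> on the number of equations exactly when \<open>big\<close>
    holds.\<close>
  define T where "T = small_exps p h (P + 2 * c + 1)"
  define D where "D = P * P + 2 * c + 1"
  define E where "E = small_exps p h D"
  have fin: "finite S" "finite T" "finite E"
    using finite_small_exps[OF p_gt_0] by (auto simp: S_def T_def E_def)
  have "card E \<le> D" unfolding E_def h_def by (rule card_small_exps(1)[OF cop p_gt_0])
  also have "D < (P - c) * (P + 2 * c + 1 - c)"
  proof -
    define k where "k = P - c"
    have "P = k + c" using big by (simp add: k_def)
    then show ?thesis using big by (simp add: D_def algebra_simps)
  qed
  also have "\<dots> \<le> card S * card T"
    unfolding S_def T_def h_def using card_small_exps(2)[OF cop p_gt_0] by (intro mult_le_mono) (simp_all only: c)
  finally have "card E < card (S \<times> T)" by (simp add: card_cartesian_product)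
  define wt where "wt = (\<lambda>(s, t). w s + P * w t)"
  define mon where "mon = (\<lambda>u (x::'k) y. case u of ((a, b), (a', b')) \<Rightarrow> x ^ (P * a + a') * y ^ (P * b + b'))"
  have "\<forall>u\<in>S \<times> T. below p f D (mon u)"
  proof clarify
    fix a b a' b' assume u: "(a, b) \<in> S" "(a', b') \<in> T"
    have "p * a + h * b + 1 \<le> P" "p * a' + h * b' < P + 2 * c + 1"
      using u by (auto simp: S_def T_def small_exps_def)
    then have "P * (p * a + h * b + 1) + (p * a' + h * b') < P * P + (P + 2 * c + 1)"
      using mult_le_mono2[of "p * a + h * b + 1" P P] by linarith
    moreover have "p * (P * a + a') + h * (P * b + b') + P = P * (p * a + h * b + 1) + (p * a' + h * b')"
      by (simp add: algebra_simps)
    ultimately have "p * (P * a + a') + h * (P * b + b') < D"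
      unfolding D_def by linarith
    then show "below p f D (mon ((a, b), (a', b')))"
      unfolding mon_def using below_monomial[OF p_gt_1 f0] by (simp add: h_def)
  qed
  then have "\<forall>u\<in>S \<times> T. \<exists>g. (\<forall>i j. coeff (g j) i \<noteq> 0 \<longrightarrow> j < p \<and> p * i + degree f * j < D) \<and>
     (\<forall>x y. y ^ p = y + poly f x \<longrightarrow> mon u x y = (\<Sum>j<p. poly (g j) x * y ^ j))"
    unfolding below_def .
  then obtain g where "\<forall>u\<in>S \<times> T. (\<forall>i j. coeff (g u j) i \<noteq> 0 \<longrightarrow> j < p \<and> p * i + degree f * j < D) \<and>
     (\<forall>x y. y ^ p = y + poly f x \<longrightarrow> mon u x y = (\<Sum>j<p. poly (g u j) x * y ^ j))"
    by (rule bchoice[THEN exE])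
  then have g: "\<And>u i j. u \<in> S \<times> T \<Longrightarrow> coeff (g u j) i \<noteq> 0 \<Longrightarrow> (i, j) \<in> E"
      "\<And>u x y. u \<in> S \<times> T \<Longrightarrow> y ^ p = y + poly f x \<Longrightarrow> mon u x y = (\<Sum>j<p. poly (g u j) x * y ^ j)"
    unfolding E_def small_exps_def h_def by blast+
  \<comment> \<open>With one reduced representation fixed per monomial, the reduced coefficients of
    \<open>F\<close> are linear in the unknowns, and only positions in \<open>E\<close> give
    equations.\<close>
  obtain cf where cf: "\<exists>u\<in>S \<times> T. cf u \<noteq> 0"
    "\<forall>e\<in>E. (\<Sum>u\<in>S \<times> T. (case e of (i, j) \<Rightarrow> coeff (g u j) i) * cf u) = 0"
    using underdetermined_system_nontrivial[OF fin(3) finite_cartesian_product[OF fin(1,2)] \<open>card E < card (S \<times> T)\<close>,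
        of "\<lambda>e u. case e of (i, j) \<Rightarrow> coeff (g u j) i"] by (elim exE conjE)
  have lin: "(\<Sum>u\<in>S \<times> T. cf u * mon u x y) = 0" if y: "y ^ p = y + poly f x" for x y
  proof -
    have z: "(\<Sum>u\<in>S \<times> T. smult (cf u) (g u j)) = 0" for j
    proof (rule poly_eqI)
      fix i
      have "(\<Sum>u\<in>S \<times> T. cf u * coeff (g u j) i) = 0"
      proof (cases "(i, j) \<in> E")
        case True
        then have "(\<Sum>u\<in>S \<times> T. coeff (g u j) i * cf u) = 0" using cf(2) by force
        then show ?thesis by (simp add: mult.commute)
      next
        case False
        then show ?thesis using g(1) by (intro sum.neutral) auto
      qed
      then show "coeff (\<Sum>u\<in>S \<times> T. smult (cf u) (g u j)) i = coeff 0 i" by (simp add: coeff_sum)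
    qed
    have "(\<Sum>u\<in>S \<times> T. cf u * mon u x y) = (\<Sum>u\<in>S \<times> T. \<Sum>j<p. poly (smult (cf u) (g u j)) x * y ^ j)"
      using g(2)[OF _ y] by (intro sum.cong) (auto simp: sum_distrib_left mult.assoc)
    also have "\<dots> = (\<Sum>j<p. poly (\<Sum>u\<in>S \<times> T. smult (cf u) (g u j)) x * y ^ j)"
      by (subst sum.swap) (simp add: poly_sum sum_distrib_right)
    finally show ?thesis by (simp add: z)
  qed
  have "\<forall>u. \<exists>d. d ^ P = cf u" unfolding P using p_gt_0 by (intro allI nth_root_exists) simp
  then obtain d where d: "\<And>u. d u ^ P = cf u" by (elim choice[THEN exE]) blast
  have P0: "P > 0" using p_gt_0 by (simp add: P)
  define G where "G = (\<lambda>x y. \<Sum>u\<in>S \<times> T. d u * (case u of ((a, b), (a', b')) \<Rightarrow> x ^ (a + P * a') * y ^ (b + P * b')))"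
  have G0: "G x y = 0" if y: "y ^ p = y + poly f x" and xQ: "x ^ Q = x" and yQ: "y ^ Q = y" for x y
  proof -
    \<comment> \<open>This is where \<open>Q\<close> must be \<open>P * P\<close>: after the
      \<open>P\<close>-th power the exponent \<open>P * P * k'\<close> collapses to
      \<open>k'\<close>, while \<open>k\<close> acquires the factor \<open>P\<close>.\<close>
    have pw: "(z ^ (k + P * k')) ^ P = z ^ (P * k + k')" if "z ^ Q = z" for z :: 'k and k k'
    proof -
      have "(z ^ (k + P * k')) ^ P = z ^ (P * k) * (z ^ Q) ^ k'"
        by (simp add: Q_def algebra_simps flip: power_mult power_add)
      then show ?thesis using that by (simp add: power_add)
    qed
    have "G x y ^ P = (\<Sum>u\<in>S \<times> T. (d u * (case u of ((a, b), (a', b')) \<Rightarrow>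
        x ^ (a + P * a') * y ^ (b + P * b'))) ^ P)"
      unfolding G_def using frob_sum[of _ "S \<times> T" s] P by simp
    also have "\<dots> = (\<Sum>u\<in>S \<times> T. cf u * mon u x y)"
      by (intro sum.cong refl) (auto simp: power_mult_distrib d mon_def pw[OF xQ] pw[OF yQ])
    also have "\<dots> = 0" by (rule lin[OF y])
    finally show ?thesis by simp
  qed
  define U where "U = {u \<in> S \<times> T. d u \<noteq> 0}"
  have U: "finite U" "U \<noteq> {}"
  proof -
    show "finite U" using fin by (simp add: U_def)
    obtain u where "u \<in> S \<times> T" "cf u \<noteq> 0" using cf(1) by blast
    then have "u \<in> U" using d[of u] P0 by (auto simp: U_def zero_power)
    then show "U \<noteq> {}" by blast
  qed
  have "Max (wt ` U) \<in> wt ` U" using U by (intro Max_in) auto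
  then obtain u0 where u0: "u0 \<in> U" "wt u0 = Max (wt ` U)" by auto
  \<comment> \<open>As \<open>w s < P\<close>, dividing the total weight by \<open>P\<close> with
    remainder recovers \<open>w t\<close> and \<open>w s\<close>, and each determines its exponent
    pair.\<close>
  have winj: "u = v" if "u \<in> S \<times> T" "v \<in> S \<times> T" "wt u = wt v" for u v
  proof -
    obtain a b a' b' where u: "u = ((a, b), (a', b'))" by (metis surj_pair)
    obtain k l k' l' where v: "v = ((k, l), (k', l'))" by (metis surj_pair)
    have lt: "w (a, b) < P" "w (k, l) < P" using that u v by (auto simp: S_def w_def small_exps_def)
    have e: "w (a, b) + P * w (a', b') = w (k, l) + P * w (k', l')" using that u v by (simp add: wt_def)
    then have "(w (a, b) + P * w (a', b')) mod P = (w (k, l) + P * w (k', l')) mod P" by simp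
    then have e1: "w (a, b) = w (k, l)" using lt by simp
    then have e2: "w (a', b') = w (k', l')" using e P0 by simp
    show ?thesis
      using inj_on_weight[of p h b l a k] inj_on_weight[of p h b' l' a' k'] that e1 e2 cop
      by (auto simp: u v w_def S_def T_def small_exps_def h_def)
  qed
  define D0 where "D0 = wt u0"
  have below_top: "wt u < D0" if "u \<in> U" "u \<noteq> u0" for u
  proof -
    have "wt u \<le> D0" using that U u0 by (simp add: D0_def)
    moreover have "wt u \<noteq> D0" using winj[of u u0] that u0 by (auto simp: D0_def U_def)
    ultimately show ?thesis by simp
  qed
  obtain a0 b0 a0' b0' where u0e: "u0 = ((a0, b0), (a0', b0'))" by (metis surj_pair)
  define A where "A = a0 + P * a0'"
  define B where "B = b0 + P * b0'"
  define i0 where "i0 = A + h * (B div p)"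
  define j0 where "j0 = B mod p"
  define \<kappa> where "\<kappa> = d u0 * lead_coeff f ^ (B div p)"
  have D0: "D0 = p * A + h * B" by (simp add: D0_def wt_def w_def u0e A_def B_def algebra_simps)
  have D0': "D0 = p * i0 + h * j0" unfolding D0 i0_def j0_def by (rule weight_reduce[symmetric])
  have j0: "j0 < p" using p_gt_0 by (simp add: j0_def)
  have \<kappa>: "\<kappa> \<noteq> 0" using u0 f0 by (auto simp: \<kappa>_def U_def)
  \<comment> \<open>The unique heaviest monomial of \<open>G\<close> reduces to
    \<open>\<kappa> * (x ^ i0 * y ^ j0)\<close> up to lower weight; every other monomial is lighter
    from the start.\<close>
  have "below p f D0 (\<lambda>x y. G x y - \<kappa> * (x ^ i0 * y ^ j0))"
  proof (rule below_cong)
    show "below p f D0 (\<lambda>x y. d u0 * (x ^ A * y ^ B - lead_coeff f ^ (B div p) * (x ^ i0 * y ^ j0)) +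
      (\<Sum>u\<in>U - {u0}. d u * (case u of ((a, b), (a', b')) \<Rightarrow> x ^ (a + P * a') * y ^ (b + P * b'))))"
    proof (intro below_add below_smult below_sum)
      show "below p f D0 (\<lambda>x y. x ^ A * y ^ B - lead_coeff f ^ (B div p) * (x ^ i0 * y ^ j0))"
        unfolding D0 i0_def j0_def h_def by (rule below_monomial_leading[OF p_gt_1 f0])
      fix u assume u: "u \<in> U - {u0}"
      obtain a b a' b' where ue: "u = ((a, b), (a', b'))" by (metis surj_pair)
      have "wt u < D0" using below_top u by auto
      also have "wt u = p * (a + P * a') + h * (b + P * b')"
        by (simp add: ue wt_def w_def algebra_simps)
      finally show "below p f D0 (\<lambda>x y. case u of ((a, b), (a', b')) \<Rightarrow> x ^ (a + P * a') * y ^ (b + P * b'))"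
        unfolding ue using below_monomial[OF p_gt_1 f0] by (simp add: h_def)
    qed
    fix x y
    have "G x y = (\<Sum>u\<in>U. d u * (case u of ((a, b), (a', b')) \<Rightarrow> x ^ (a + P * a') * y ^ (b + P * b')))"
      unfolding G_def using fin by (intro sum.mono_neutral_right) (auto simp: U_def)
    also have "\<dots> = d u0 * (x ^ A * y ^ B) +
      (\<Sum>u\<in>U - {u0}. d u * (case u of ((a, b), (a', b')) \<Rightarrow> x ^ (a + P * a') * y ^ (b + P * b')))"
      by (subst sum.remove[OF U(1) u0(1)]) (simp add: u0e A_def B_def)
    finally show "G x y - \<kappa> * (x ^ i0 * y ^ j0) =
      d u0 * (x ^ A * y ^ B - lead_coeff f ^ (B div p) * (x ^ i0 * y ^ j0)) +
      (\<Sum>u\<in>U - {u0}. d u * (case u of ((a, b), (a', b')) \<Rightarrow> x ^ (a + P * a') * y ^ (b + P * b')))"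
      by (simp add: \<kappa>_def algebra_simps)
  qed
  then obtain r where r: "\<And>i j. coeff (r j) i \<noteq> 0 \<Longrightarrow> p * i + h * j < D0"
    "\<And>x y. y ^ p = y + poly f x \<Longrightarrow> G x y - \<kappa> * (x ^ i0 * y ^ j0) = (\<Sum>j<p. poly (r j) x * y ^ j)"
    unfolding below_def h_def by blast
  \<comment> \<open>The coefficient of \<open>y ^ j0\<close> in the reduced form of
    \<open>G\<close>. A term of \<open>r j0\<close> of degree at least \<open>i0\<close> would weigh
    \<open>D0\<close> or more, so \<open>\<kappa>\<close> survives as leading coefficient.\<close>
  define k where "k = monom \<kappa> i0 + r j0"
  have ri: "coeff (r j0) i = 0" if "i \<ge> i0" for i
  proof (rule ccontr)
    assume "coeff (r j0) i \<noteq> 0"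
    then have "p * i < p * i0" using r(1)[of j0 i] by (simp add: D0')
    then show False using that by simp
  qed
  have k0: "k \<noteq> 0"
  proof
    assume "k = 0"
    then have "coeff k i0 = 0" by simp
    with \<kappa> show False by (simp add: k_def ri)
  qed
  have dk: "degree k \<le> i0" by (rule degree_le) (auto simp: k_def ri)
  have kX: "poly k x = 0" if x: "x \<in> Z" for x
  proof -
    obtain y0 where y0: "y0 ^ p = y0 + poly f x" using artin_schreier_root by blast
    \<comment> \<open>The reduced form of \<open>G\<close> at a fixed \<open>x\<close>, a polynomial
      in \<open>y\<close> of degree below \<open>p\<close>. The \<open>p\<close> points
      \<open>y0 + v\<close> above \<open>x\<close> are all fixed by the \<open>Q\<close>-th power,
      hence roots, so every coefficient vanishes.\<close>
    define R where "R = (\<Sum>j<p. monom (poly (r j) x + (if j = j0 then \<kappa> * x ^ i0 else 0)) j)"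
    have R: "poly R y = (\<Sum>j<p. poly (r j) x * y ^ j) + \<kappa> * (x ^ i0 * y ^ j0)" for y
    proof -
      have "poly R y = (\<Sum>j<p. poly (r j) x * y ^ j + (if j = j0 then \<kappa> * (x ^ i0 * y ^ j0) else 0))"
        unfolding R_def poly_sum by (intro sum.cong) (auto simp: poly_monom algebra_simps)
      then show ?thesis using j0 by (simp add: sum.distrib)
    qed
    have root: "poly R (y0 + v) = 0" if v: "v \<in> Fix p" for v
    proof -
      define y where "y = y0 + v"
      have y: "y ^ p = y + poly f x"
        using v y0 frob_add[of y0 v 1] by (simp add: y_def fixed_pts_def)
      have "y ^ Q = y" using artin_schreier_frob[OF y, of "2 * s"] tr[OF x] by (simp add: Q)
      then have "G x y = 0" using G0[OF y] Z x by (auto simp: Q fixed_pts_def)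
      then show ?thesis unfolding R y_def[symmetric] r(2)[OF y, symmetric] by simp
    qed
    have "R = 0"
    proof (rule ccontr)
      assume R0: "R \<noteq> 0"
      have "degree R \<le> p - 1" unfolding R_def
        by (intro degree_sum_le) (auto intro: order_trans[OF degree_monom_le])
      then have "card {y. poly R y = 0} \<le> p - 1" using card_poly_roots_bound[OF R0] by simp
      moreover have "card ((+) y0 ` Fix p) \<le> card {y. poly R y = 0}"
        using root by (intro card_mono poly_roots_finite R0) auto
      ultimately show False using p_gt_0 card_Fix[of 1] by (simp add: card_image)
    qed
    then have "coeff R j0 = 0" by simp
    then show ?thesis using j0 by (simp add: R_def coeff_sum k_def poly_monom add.commute)
  qed
  have "card Z \<le> card {x. poly k x = 0}"
    using kX by (intro card_mono poly_roots_finite k0) auto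
  also have "\<dots> \<le> i0" using card_poly_roots_bound[OF k0] dk by simp
  finally have "p * card Z \<le> p * i0" by simp
  also have "\<dots> \<le> D0" by (simp add: D0')
  also have "D0 \<le> P + P * (P + 2 * c)"
  proof -
    have "w (a0, b0) \<le> P" "w (a0', b0') \<le> P + 2 * c"
      using u0 by (auto simp: U_def u0e S_def T_def small_exps_def w_def)
    then show ?thesis by (auto simp: D0_def wt_def u0e intro!: add_mono)
  qed
  finally show ?thesis by (simp add: algebra_simps)
qed

lemma sum_chi_Fix: "(\<Sum>u\<in>Fix p. chi u) = 0"
proof -
  have one: "(1::'k) \<in> Fix p" by (simp add: fixed_pts_def)
  have "(\<Sum>u\<in>Fix p. chi u) = (\<Sum>u\<in>Fix p. chi (u + 1))"
    using frob_add[of _ 1 1] frob_diff[of _ 1 1]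
    by (intro sum.reindex_bij_witness[of _ "\<lambda>u. u + 1" "\<lambda>u. u - 1"]) (auto simp: fixed_pts_def)
  also have "\<dots> = (\<Sum>u\<in>Fix p. chi u) * chi 1"
    by (simp add: chi_add[OF _ one] sum_distrib_right)
  finally show ?thesis using chi_eq_1_iff[OF one] by simp
qed

text \<open>The upper bound on each fibre of the trace is turned into a bound on the sum by comparing the
  (nonnegative) deficits with their total.\<close>
lemma stepanov_sum_bound:
  fixes f :: "'k poly"
  assumes cop: "coprime p (degree f)" and f0: "degree f > 0"
    and c: "c = p * degree f" and big: "c * c + 3 * c + 1 < p ^ s"
    and fF: "\<And>x. x \<in> Fix (p ^ (2 * s)) \<Longrightarrow> poly f x \<in> Fix (p ^ (2 * s))"
  shows "cmod (\<Sum>x\<in>Fix (p ^ (2 * s)). chi (Tr (2 * s) (poly f x))) \<le> real (2 * c + 1) * real p ^ s"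
proof -
  define P where "P = p ^ s"
  define F where "F = Fix (p ^ (2 * s))"
  have s0: "s > 0" using big by (cases s) auto
  have finF: "finite F" unfolding F_def using s0 by (intro Fix_finite_power) simp
  have cardF: "card F = P * P"
    unfolding F_def using s0 by (subst card_Fix) (auto simp: P_def mult_2 power_add)
  define t where "t = (\<lambda>x. Tr (2 * s) (poly f x))"
  define N where "N = (\<lambda>u. card {x \<in> F. t x = u})"
  define M where "M = P * P + (2 * c + 1) * P"
  have N: "p * N u \<le> M" for u
  proof (cases "\<exists>x1\<in>F. t x1 = u")
    case True
    then obtain x1 where x1: "x1 \<in> F" "t x1 = u" by blast
    \<comment> \<open>Subtracting the value at one point of the fibre moves the fibre to trace zero
      without changing the degree.\<close>
    define f' where "f' = f + [:- poly f x1:]"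
    have df: "degree f' = degree f" unfolding f'_def using f0 by (intro degree_add_eq_left) simp
    show ?thesis unfolding N_def M_def
    proof (rule stepanov_card_bound[of f'])
      show "coprime p (degree f')" "degree f' > 0" "c = p * degree f'" using cop f0 c df by auto
      fix x assume "x \<in> {x \<in> F. t x = u}"
      then show "Tr (2 * s) (poly f' x) = 0"
        using x1 Tr_diff[of "2 * s" "poly f x" "poly f x1"] by (simp add: f'_def t_def)
    qed (use big in \<open>auto simp: P_def F_def\<close>)
  next
    case False
    then have "{x \<in> F. t x = u} = {}" by auto
    then show ?thesis by (simp only: N_def card.empty mult_0_right zero_le)
  qed
  have finP: "finite (Fix p)" by (rule Fix_finite[OF p_gt_1])
  have tF: "t ` F \<subseteq> Fix p" using fF by (auto simp: t_def F_def intro: Tr_in_Fix)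
  have total: "(\<Sum>u\<in>Fix p. N u) = P * P"
    using sum.group[OF finF finP tF, of "\<lambda>_. 1 :: nat"] cardF by (simp only: N_def card_eq_sum)
  have "(\<Sum>x\<in>F. chi (t x)) = (\<Sum>u\<in>Fix p. \<Sum>x\<in>{x \<in> F. t x = u}. chi (t x))"
    by (rule sum.group[OF finF finP tF, symmetric])
  also have "\<dots> = (\<Sum>u\<in>Fix p. of_nat (N u) * chi u)" by (simp add: N_def)
  finally have S: "(\<Sum>x\<in>F. chi (t x)) = (\<Sum>u\<in>Fix p. of_nat (N u) * chi u)" .
  have dif: "(of_nat (M - p * N u) :: 'b::ring_1) = of_nat M - of_nat p * of_nat (N u)" for u
    using N[of u] by (simp add: of_nat_diff)
  \<comment> \<open>The constant \<open>M\<close> drops out since \<open>chi\<close> sums to zero,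
    and the deficits total \<open>p * M - p * (P * P) = p * (2 * c + 1) * P\<close>.\<close>
  have "(\<Sum>u\<in>Fix p. of_nat (M - p * N u) * chi u) =
      of_nat M * (\<Sum>u\<in>Fix p. chi u) - of_nat p * (\<Sum>u\<in>Fix p. of_nat (N u) * chi u)"
    by (simp only: dif left_diff_distrib sum_subtractf sum_distrib_left mult.assoc)
  then have "of_nat p * (\<Sum>x\<in>F. chi (t x)) = - (\<Sum>u\<in>Fix p. of_nat (M - p * N u) * chi u)"
    unfolding S sum_chi_Fix by simp
  then have "cmod (of_nat p * (\<Sum>x\<in>F. chi (t x))) = cmod (\<Sum>u\<in>Fix p. of_nat (M - p * N u) * chi u)"
    by (simp only: norm_minus_cancel)
  also have "\<dots> \<le> (\<Sum>u\<in>Fix p. real (M - p * N u))"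
    by (intro sum_norm_le) (simp only: norm_mult norm_chi norm_of_nat mult_1_right order_refl)
  also have "\<dots> = real (card (Fix p)) * real M - real p * real (\<Sum>u\<in>Fix p. N u)"
    by (simp only: dif sum_subtractf sum_distrib_left of_nat_sum sum_constant)
  also have "\<dots> = real p * (real (2 * c + 1) * real P)"
    using card_Fix[of 1] unfolding total M_def by (simp add: algebra_simps)
  finally have "real p * cmod (\<Sum>x\<in>F. chi (t x)) \<le> real p * (real (2 * c + 1) * real P)"
    by (simp add: norm_mult)
  then have "cmod (\<Sum>x\<in>F. chi (t x)) \<le> real (2 * c + 1) * real P"
    by (rule mult_left_le_imp_le) (use p_gt_0 in simp)
  then show ?thesis by (simp add: F_def t_def P_def)
qed

end

section \<open>Conjugate orbits and monic polynomials\<close>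

text \<open>For \<open>x\<close> in \<open>fixed_pts (q ^ k)\<close> this is the characteristic
  polynomial of \<open>x\<close> over the field with \<open>q\<close> elements: conjugates repeat
  when the degree of \<open>x\<close> is a proper divisor of \<open>k\<close>.\<close>

definition orbit_poly :: "nat \<Rightarrow> nat \<Rightarrow> 'k::field \<Rightarrow> 'k poly" where
  "orbit_poly q k x = (\<Prod>i<k. [:-(x ^ q ^ i), 1:])"

definition monics :: "nat \<Rightarrow> nat \<Rightarrow> 'k::field poly set" where
  "monics q d = {g. lead_coeff g = 1 \<and> degree g = d \<and> (\<forall>i. coeff g i \<in> fixed_pts q)}"

lemma orbit_poly_monic: "lead_coeff (orbit_poly q k x) = 1"
  by (simp add: orbit_poly_def lead_coeff_prod)

lemma orbit_poly_degree: "degree (orbit_poly q k x) = k"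
  unfolding orbit_poly_def by (subst degree_prod_eq_sum_degree) auto

lemma proots_orbit_poly:
  "proots (orbit_poly q k x) = (\<Sum>i<k. {#x ^ q ^ i#})"
  unfolding orbit_poly_def by (subst proots_prod) (auto simp del: power_mult)

section \<open>Descent of polynomials to the field with q elements\<close>

locale subfield_of_closed = closed_field_char p TYP
  for p :: nat and TYP :: "'k::alg_closed_field itself" +
  fixes n q :: nat
  assumes n_pos: "n > 0" and q_def: "q = p ^ n"
begin

lemma q_gt_1: "q > 1" unfolding q_def by (rule one_less_power[OF p_gt_1 n_pos])

lemma q_power: "q ^ k = p ^ (n * k)" by (simp add: q_def power_mult)

lemma finite_Fix_q: "finite (Fix q)" by (rule Fix_finite[OF q_gt_1])

lemma frob_q_add: "(x + y :: 'k) ^ q ^ k = x ^ q ^ k + y ^ q ^ k" unfolding q_power by (rule frob_add)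
lemma frob_q_sum: "(sum \<phi> A :: 'k) ^ q ^ k = (\<Sum>i\<in>A. \<phi> i ^ q ^ k)" unfolding q_power by (rule frob_sum)
lemma frob_q_inj: "(x :: 'k) ^ q ^ k = y ^ q ^ k \<Longrightarrow> x = y" unfolding q_power by (rule frob_inj)

text \<open>Turns being defined over \<open>Fix q\<close> into the equation
  \<open>conj_poly g = g\<close>, which passes to products and to cofactors.\<close>

definition conj_poly :: "'k poly \<Rightarrow> 'k poly" where
  "conj_poly g = map_poly (\<lambda>x. x ^ q) g"

lemma q_0: "(0::'k) ^ q = 0" using q_gt_1 by (simp add: zero_power)

lemma coeff_conj_poly: "coeff (conj_poly g) i = coeff g i ^ q"
  by (simp add: conj_poly_def coeff_map_poly q_0)

lemma conj_poly_mult: "conj_poly (g * h) = conj_poly g * conj_poly h"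
proof (rule poly_eqI)
  fix i
  show "coeff (conj_poly (g * h)) i = coeff (conj_poly g * conj_poly h) i"
    using frob_q_sum[of "\<lambda>j. coeff g j * coeff h (i - j)" "{..i}" 1]
    by (simp add: coeff_conj_poly coeff_mult power_mult_distrib)
qed

lemma conj_poly_linear: "conj_poly [:-x, 1:] = [:-(x ^ q), 1:]"
  using frob_minus[of x n] by (intro poly_eqI) (auto simp: coeff_conj_poly coeff_pCons q_def[symmetric] q_0 split: nat.split)

lemma conj_poly_1: "conj_poly 1 = 1"
  by (intro poly_eqI) (auto simp: coeff_conj_poly coeff_1 q_0)

lemma conj_poly_prod: "conj_poly (\<Prod>i\<in>I. \<phi> i) = (\<Prod>i\<in>I. conj_poly (\<phi> i))"
  by (induction I rule: infinite_finite_induct) (auto simp: conj_poly_1 conj_poly_mult)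

lemma conj_poly_prod_mset: "conj_poly (\<Prod>i\<in>#I. \<phi> i) = (\<Prod>i\<in>#I. conj_poly (\<phi> i))"
  by (induction I) (auto simp: conj_poly_1 conj_poly_mult)

lemma conj_poly_power: "conj_poly (g ^ m) = conj_poly g ^ m"
  by (induction m) (auto simp: conj_poly_1 conj_poly_mult)

lemma conj_poly_eq_iff: "conj_poly g = g \<longleftrightarrow> (\<forall>i. coeff g i \<in> Fix q)"
  by (simp add: poly_eq_iff coeff_conj_poly fixed_pts_def)

lemma mem_monics: "g \<in> monics q d \<longleftrightarrow> lead_coeff g = 1 \<and> degree g = d \<and> conj_poly g = g"
  by (simp add: monics_def conj_poly_eq_iff)

lemma monics_neq_0: "g \<in> monics q d \<Longrightarrow> g \<noteq> 0"
  by (auto simp: monics_def)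

lemma poly_frob:
  assumes "conj_poly f = f" shows "poly f x ^ q ^ i = poly f (x ^ q ^ i)"
proof (induction i)
  case (Suc i)
  have "poly f y ^ q = poly f (y ^ q)" for y
  proof -
    have "poly f y ^ q = (\<Sum>j\<le>degree f. (coeff f j * y ^ j) ^ q)"
      using frob_q_sum[of "\<lambda>j. coeff f j * y ^ j" "{..degree f}" 1] by (simp add: poly_altdef)
    also have "\<dots> = (\<Sum>j\<le>degree f. coeff f j * (y ^ q) ^ j)"
      using assms by (intro sum.cong)
        (auto simp: conj_poly_eq_iff fixed_pts_def power_mult_distrib mult.commute simp flip: power_mult)
    finally show ?thesis by (simp add: poly_altdef)
  qed
  then show ?case using Suc by (metis power_Suc2 power_mult)
qed simp

lemma finite_monics: "finite (monics q d :: 'k poly set)"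
proof -
  define \<phi> where "\<phi> = (\<lambda>g :: 'k poly. map (coeff g) [0..<Suc d])"
  have "inj_on \<phi> (monics q d)"
  proof (rule inj_onI)
    fix g h assume gh: "g \<in> monics q d" "h \<in> monics q d" "\<phi> g = \<phi> h"
    show "g = h"
    proof (rule poly_eqI)
      fix i
      show "coeff g i = coeff h i"
      proof (cases "i \<le> d")
        case True
        then have "\<phi> g ! i = coeff g i" "\<phi> h ! i = coeff h i"
          unfolding \<phi>_def by (auto simp del: upt_Suc)
        with gh(3) show ?thesis by simp
      next
        case False
        then show ?thesis using gh by (auto simp: monics_def coeff_eq_0)
      qed
    qed
  qed
  moreover have "\<phi> ` monics q d \<subseteq> {xs. set xs \<subseteq> Fix q \<and> length xs = Suc d}"
    by (auto simp: \<phi>_def monics_def fixed_pts_def)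
  ultimately show ?thesis
    using finite_lists_length_eq[OF finite_Fix_q, of "Suc d"] by (metis finite_subset finite_imageD)
qed

lemma monics_0: "monics q 0 = {1 :: 'k poly}"
proof -
  have "g = 1" if "g \<in> monics q 0" for g :: "'k poly"
    using that by (auto simp: monics_def elim!: degree_eq_zeroE)
  moreover have "1 \<in> (monics q 0 :: 'k poly set)" by (simp add: mem_monics conj_poly_1)
  ultimately show ?thesis by blast
qed

text \<open>Conjugation shifts the factors by one, and the last wraps around because
  \<open>x ^ q ^ k = x\<close>.\<close>

lemma orbit_poly_in_monics:
  assumes "x \<in> Fix (q ^ k)" shows "orbit_poly q k x \<in> monics q k"
proof -
  have "conj_poly (orbit_poly q k x) = (\<Prod>i<k. [:-(x ^ q ^ Suc i), 1:])"
    unfolding orbit_poly_def conj_poly_prod conj_poly_linear by (simp add: mult.commute flip: power_mult)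
  also have "\<dots> = orbit_poly q k x"
  proof (cases k)
    case (Suc m)
    have "(\<Prod>i<Suc m. [:-(x ^ q ^ Suc i), 1:]) = (\<Prod>i<m. [:-(x ^ q ^ Suc i), 1:]) * [:-(x ^ q ^ 0), 1:]"
      using assms Suc by (simp add: fixed_pts_def)
    also have "\<dots> = (\<Prod>i<Suc m. [:-(x ^ q ^ i), 1:])"
      by (simp only: prod.lessThan_Suc_shift mult.commute)
    finally show ?thesis by (simp only: Suc orbit_poly_def)
  qed (simp add: orbit_poly_def)
  finally show ?thesis unfolding mem_monics using orbit_poly_monic orbit_poly_degree by blast
qed

lemma order_frob_le:
  assumes "conj_poly g = g" "g \<noteq> 0" shows "order x g \<le> order (x ^ q ^ i) g"
proof (induction i)
  case (Suc i)
  define y where "y = x ^ q ^ i"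
  have "[:-y, 1:] ^ order y g dvd g" by (rule order_1)
  then obtain h where "g = [:-y, 1:] ^ order y g * h" by (elim dvdE)
  then have "conj_poly g = [:-(y ^ q), 1:] ^ order y g * conj_poly h"
    by (metis conj_poly_linear conj_poly_mult conj_poly_power)
  then have "[:-(y ^ q), 1:] ^ order y g dvd g" using assms(1) by (metis dvd_triv_left)
  then have "order y g \<le> order (y ^ q) g" using assms(2) by (simp add: order_divides)
  also have "y ^ q = x ^ q ^ Suc i" by (simp add: y_def mult.commute flip: power_mult)
  finally show ?case using Suc by (simp add: y_def)
qed simp

section \<open>Orbit polynomials dividing a given polynomial\<close>

lemma orbit_poly_mult:
  assumes "x \<in> Fix (q ^ d)"
  shows "orbit_poly q (d * j) x = orbit_poly q d x ^ j"
proof (induction j)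
  case (Suc j)
  have "orbit_poly q (d + d * j) x = (\<Prod>i<d. [:-(x ^ q ^ i), 1:]) * (\<Prod>i<d * j. [:-(x ^ q ^ (d + i)), 1:])"
    unfolding orbit_poly_def using prod.nat_group[of "\<lambda>_. 1"]
    by (simp add: lessThan_atLeast0 prod.atLeastLessThan_shift_0[of _ d "d + d * j"] comp_def
        flip: prod.atLeastLessThan_concat[of 0 d "d + d * j"])
  also have "(\<Prod>i<d * j. [:-(x ^ q ^ (d + i)), 1:]) = orbit_poly q (d * j) x"
    unfolding orbit_poly_def using assms by (simp add: power_add power_mult fixed_pts_def)
  finally show ?case using Suc by (simp add: orbit_poly_def)
qed (simp add: orbit_poly_def)

text \<open>Frobenius is injective and maps the finitely many roots of \<open>g\<close> to roots, so
  the orbit of \<open>x\<close> returns to \<open>x\<close>; \<open>d\<close> is its length, the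
  degree of \<open>x\<close> over \<open>Fix q\<close>.\<close>

lemma minimal_period:
  assumes g: "g \<in> monics q r" and x: "poly g x = 0"
  obtains d where "d > 0" "\<And>k. x \<in> Fix (q ^ k) \<longleftrightarrow> d dvd k" "inj_on (\<lambda>i. x ^ q ^ i) {..<d}"
proof -
  have g0: "g \<noteq> 0" and cg: "conj_poly g = g" using g by (auto simp: monics_neq_0 mem_monics)
  have period: "x ^ q ^ (j - i) = x" if "i < j" "x ^ q ^ i = x ^ q ^ j" for i j
  proof -
    have "(x ^ q ^ (j - i)) ^ q ^ i = x ^ q ^ j"
      using that(1) by (simp flip: power_mult power_add)
    then show ?thesis using that(2) frob_q_inj by metis
  qed
  have "\<exists>k>0. x ^ q ^ k = x"
  proof -
    have "range (\<lambda>i. x ^ q ^ i) \<subseteq> {y. poly g y = 0}"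
      using poly_frob[OF cg, of x] x q_gt_1 by (auto simp: zero_power)
    then have "finite (range (\<lambda>i. x ^ q ^ i))" using poly_roots_finite[OF g0] finite_subset by blast
    then have "\<not> inj (\<lambda>i. x ^ q ^ i)" using finite_imageD infinite_UNIV_nat by blast
    then obtain i j where "x ^ q ^ i = x ^ q ^ j" "i \<noteq> j" by (auto simp: inj_def)
    then have "\<exists>i j. i < j \<and> x ^ q ^ i = x ^ q ^ j" by (metis linorder_neq_iff)
    then show ?thesis using period by (metis zero_less_diff)
  qed
  define d where "d = (LEAST k. k > 0 \<and> x ^ q ^ k = x)"
  have d: "d > 0" "x ^ q ^ d = x"
    using LeastI_ex[OF \<open>\<exists>k>0. x ^ q ^ k = x\<close>] by (simp_all add: d_def)
  have least: "k = 0" if "k < d" "x ^ q ^ k = x" for k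
    using not_less_Least[of k "\<lambda>k. k > 0 \<and> x ^ q ^ k = x"] that by (auto simp: d_def)
  have mult: "x ^ q ^ (d * j) = x" for j
    using Fix_power[of x "q ^ d" j] d(2) by (simp add: fixed_pts_def power_mult)
  have "x \<in> Fix (q ^ k) \<longleftrightarrow> d dvd k" for k
  proof -
    have "x ^ q ^ k = (x ^ q ^ (d * (k div d))) ^ q ^ (k mod d)"
      by (simp flip: power_mult power_add)
    then have "x ^ q ^ k = x ^ q ^ (k mod d)" by (simp only: mult)
    then have "x \<in> Fix (q ^ k) \<longleftrightarrow> k mod d = 0"
      using least[of "k mod d"] d by (auto simp: fixed_pts_def)
    then show ?thesis by (simp add: dvd_eq_mod_eq_0)
  qed
  moreover have "inj_on (\<lambda>i. x ^ q ^ i) {..<d}"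
  proof (rule linorder_inj_onI')
    fix i j assume "i \<in> {..<d}" "j \<in> {..<d}" "i < j"
    then show "x ^ q ^ i \<noteq> x ^ q ^ j" using period[of i j] least[of "j - i"] less_imp_diff_less[of j d i] by auto
  qed
  ultimately show thesis using that d(1) by blast
qed

text \<open>With \<open>d\<close> the degree of \<open>x\<close>, only multiples
  \<open>k = d * j\<close> occur. Their orbit polynomial is the \<open>j\<close>-th power of the
  minimal polynomial, and it divides \<open>g\<close> iff \<open>j\<close> is at most
  \<open>order x g\<close>, since no conjugate has smaller multiplicity than
  \<open>x\<close>.\<close>

lemma card_orbit_divisors_at_root:
  assumes g: "g \<in> monics q r" and x: "poly g x = 0"
  shows "card {k \<in> {1..r}. x \<in> Fix (q ^ k) \<and> orbit_poly q k x dvd g} = order x g"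
proof -
  have g0: "g \<noteq> 0" and cg: "conj_poly g = g" and lg: "lead_coeff g = 1" and dg: "degree g = r"
    using g by (auto simp: monics_neq_0 mem_monics)
  obtain d where d: "d > 0" "\<And>k. x \<in> Fix (q ^ k) \<longleftrightarrow> d dvd k" "inj_on (\<lambda>i. x ^ q ^ i) {..<d}"
    using minimal_period[OF g x] by blast
  have xd: "x \<in> Fix (q ^ d)" by (simp add: d(2))
  have dvd: "orbit_poly q (d * j) x dvd g \<longleftrightarrow> j \<le> order x g" for j
  proof
    assume "orbit_poly q (d * j) x dvd g"
    moreover have "[:-x, 1:] dvd orbit_poly q d x"
      unfolding orbit_poly_def using d(1) by (intro dvd_prodI[of _ 0, THEN dvd_trans[rotated]]) auto
    then have "[:-x, 1:] ^ j dvd orbit_poly q (d * j) x"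
      unfolding orbit_poly_mult[OF xd] by (rule dvd_power_same)
    ultimately show "j \<le> order x g" using g0 by (meson dvd_trans order_divides)
  next
    assume j: "j \<le> order x g"
    show "orbit_poly q (d * j) x dvd g"
    proof (rule proots_subset_imp_dvd[OF orbit_poly_monic lg], rule mset_subset_eqI)
      fix y
      have e: "count (proots (orbit_poly q (d * j) x)) y = j * (\<Sum>i<d. if x ^ q ^ i = y then 1 else 0)"
        unfolding orbit_poly_mult[OF xd] proots_power proots_orbit_poly by (simp add: count_sum cong: if_cong)
      have c1: "(\<Sum>i<d. if x ^ q ^ i = y then 1 else 0 :: nat) = card {i \<in> {..<d}. x ^ q ^ i = y}"
        by (simp flip: sum.inter_filter)
      show "count (proots (orbit_poly q (d * j) x)) y \<le> count (proots g) y"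
      proof (cases "\<exists>i<d. x ^ q ^ i = y")
        case True
        then obtain i where i: "i < d" "x ^ q ^ i = y" by blast
        have "{i \<in> {..<d}. x ^ q ^ i = y} = {i}" using d(3) i by (auto simp: inj_on_def)
        then have "count (proots (orbit_poly q (d * j) x)) y = j" unfolding e c1 by simp
        also have "\<dots> \<le> order y g" using order_frob_le[OF cg g0, of x i] j i by simp
        finally show ?thesis using g0 by simp
      next
        case False
        then have "{i \<in> {..<d}. x ^ q ^ i = y} = {}" by auto
        then show ?thesis unfolding e c1 by (simp only: card.empty mult_0_right zero_le)
      qed
    qed
  qed
  have "{k \<in> {1..r}. x \<in> Fix (q ^ k) \<and> orbit_poly q k x dvd g} = (\<lambda>j. d * j) ` {1..order x g}"
  proof (intro equalityI subsetI)
    fix k assume k: "k \<in> {k \<in> {1..r}. x \<in> Fix (q ^ k) \<and> orbit_poly q k x dvd g}"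
    then obtain j where j: "k = d * j" using d(2) by (auto elim: dvdE)
    then show "k \<in> (\<lambda>j. d * j) ` {1..order x g}" using k dvd[of j] by (intro image_eqI[of _ _ j]) (auto intro: Suc_leI)
  next
    fix k assume "k \<in> (\<lambda>j. d * j) ` {1..order x g}"
    then obtain j where j: "k = d * j" "1 \<le> j" "j \<le> order x g" by force
    then have "orbit_poly q k x dvd g" using dvd by simp
    moreover from this have "k \<le> r"
      using dvd_imp_degree_le[OF _ g0] by (metis orbit_poly_degree dg)
    ultimately show "k \<in> {k \<in> {1..r}. x \<in> Fix (q ^ k) \<and> orbit_poly q k x dvd g}"
      using j d by auto
  qed
  then show ?thesis using d(1) by (simp add: card_image inj_on_def)
qed

text \<open>The analogue of summing the von Mangoldt function over divisors: after exchanging sums,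
  each root contributes its multiplicity, and multiplicities add up to the degree. This stands in
  for unique factorization and the Euler product.\<close>

lemma card_orbit_divisors:
  assumes g: "g \<in> monics q r"
  shows "(\<Sum>k\<in>{1..r}. card {x \<in> Fix (q ^ k). orbit_poly q k x dvd g}) = r"
proof -
  have g0: "g \<noteq> 0" and dg: "degree g = r" using g by (auto simp: monics_neq_0 mem_monics)
  define R where "R = {x. poly g x = 0}"
  have fin: "finite R" unfolding R_def by (rule poly_roots_finite[OF g0])
  define K where "K = (\<lambda>x. {k \<in> {1..r}. x \<in> Fix (q ^ k) \<and> orbit_poly q k x dvd g})"
  have root: "x \<in> R" if "k \<ge> 1" "orbit_poly q k x dvd g" for k x
  proof -
    have "[:-x, 1:] dvd orbit_poly q k x"
      unfolding orbit_poly_def using that by (intro dvd_prodI[of _ 0, THEN dvd_trans[rotated]]) auto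
    then have "[:-x, 1:] dvd g" using that dvd_trans by blast
    then show ?thesis by (simp add: R_def poly_eq_0_iff_dvd)
  qed
  have "(\<Sum>k\<in>{1..r}. card {x \<in> Fix (q ^ k). orbit_poly q k x dvd g}) =
      (\<Sum>k\<in>{1..r}. \<Sum>x\<in>R. if k \<in> K x then 1 else 0)"
  proof (intro sum.cong refl)
    fix k assume k: "k \<in> {1..r}"
    then have "{x \<in> Fix (q ^ k). orbit_poly q k x dvd g} = {x \<in> R. k \<in> K x}"
      using root by (auto simp: K_def)
    then show "card {x \<in> Fix (q ^ k). orbit_poly q k x dvd g} = (\<Sum>x\<in>R. if k \<in> K x then 1 else 0)"
      using fin by (simp flip: sum.inter_filter)
  qed
  also have "\<dots> = (\<Sum>x\<in>R. \<Sum>k\<in>{1..r}. if k \<in> K x then 1 else 0)" by (rule sum.swap)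
  also have "\<dots> = (\<Sum>x\<in>R. order x g)"
  proof (intro sum.cong refl)
    fix x assume "x \<in> R"
    then have "card (K x) = order x g" unfolding K_def R_def using card_orbit_divisors_at_root[OF g] by simp
    moreover have "{k \<in> {1..r}. k \<in> K x} = K x" by (auto simp: K_def)
    moreover have "(\<Sum>k\<in>{1..r}. if k \<in> K x then 1 else 0) = card {k \<in> {1..r}. k \<in> K x}"
      by (simp flip: sum.inter_filter)
    ultimately show "(\<Sum>k\<in>{1..r}. if k \<in> K x then 1 else 0) = order x g" by (simp only:)
  qed
  also have "\<dots> = size (proots g)"
    unfolding size_multiset_overloaded_eq using g0 by (simp add: R_def)
  also have "\<dots> = r" by (simp add: size_proots_alg_closed dg)
  finally show ?thesis .
qed

end

section \<open>The L-function\<close>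

text \<open>Coefficients counted from the top: for monic \<open>g\<close>, up to sign the elementary
  symmetric functions of the roots. The value 0 beyond the degree keeps Newton's identities valid in
  every degree.\<close>

definition monic_coeff :: "'k::field poly \<Rightarrow> nat \<Rightarrow> 'k" where
  "monic_coeff g k = (if k \<le> degree g then coeff g (degree g - k) else 0)"

lemma monic_coeff_linear_mult:
  fixes g :: "'k::field poly"
  assumes "g \<noteq> 0"
  shows "monic_coeff ([:-x, 1:] * g) (Suc k) = monic_coeff g (Suc k) - x * monic_coeff g k"
proof -
  have deg: "degree ([:-x, 1:] * g) = Suc (degree g)"
    using assms by (subst degree_mult_eq) auto
  consider "Suc k \<le> degree g" | "k = degree g" | "degree g < k" by linarith
  then show ?thesis
  proof cases
    case 1
    then have "degree g - k = Suc (degree g - Suc k)" by simp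
    then show ?thesis using 1 unfolding monic_coeff_def deg by (simp add: coeff_pCons)
  qed (unfold monic_coeff_def deg, auto simp: coeff_pCons)
qed

text \<open>Newton's identities for the exponents 1, 2 and 4. Adding a root \<open>x\<close> changes
  the coefficients by \<open>c' (Suc k) = c (Suc k) - x * c k\<close>, which reduces each identity
  to a polynomial one.\<close>

lemma power_sums_roots:
  fixes A :: "'k::field multiset"
  defines "c \<equiv> monic_coeff (\<Prod>x\<in>#A. [:-x, 1:])"
  shows "c 0 = 1" "(\<Sum>x\<in>#A. x) = - c 1" "(\<Sum>x\<in>#A. x ^ 2) = c 1 ^ 2 - 2 * c 2"
    "(\<Sum>x\<in>#A. x ^ 4) = c 1 ^ 4 - 4 * c 1 ^ 2 * c 2 + 2 * c 2 ^ 2 + 4 * c 1 * c 3 - 4 * c 4"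
proof -
  have "let c = monic_coeff (\<Prod>x\<in>#A. [:-x, 1:]) in c 0 = 1 \<and> (\<Sum>x\<in>#A. x) = - c 1 \<and>
    (\<Sum>x\<in>#A. x ^ 2) = c 1 ^ 2 - 2 * c 2 \<and>
    (\<Sum>x\<in>#A. x ^ 4) = c 1 ^ 4 - 4 * c 1 ^ 2 * c 2 + 2 * c 2 ^ 2 + 4 * c 1 * c 3 - 4 * c 4"
  proof (induction A)
    case empty
    then show ?case by (simp add: monic_coeff_def)
  next
    case (add x A)
    define g where "g = (\<Prod>x\<in>#A. [:-x, 1:])"
    have g0: "g \<noteq> 0" by (auto simp: g_def prod_mset_zero_iff)
    define c where "c = monic_coeff g"
    have IH: "c 0 = 1" "(\<Sum>x\<in>#A. x) = - c 1" "(\<Sum>x\<in>#A. x ^ 2) = c 1 ^ 2 - 2 * c 2"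
      "(\<Sum>x\<in>#A. x ^ 4) = c 1 ^ 4 - 4 * c 1 ^ 2 * c 2 + 2 * c 2 ^ 2 + 4 * c 1 * c 3 - 4 * c 4"
      using add unfolding c_def g_def Let_def by simp_all
    define c' where "c' = monic_coeff (\<Prod>x\<in>#add_mset x A. [:-x, 1:])"
    have c': "c' = monic_coeff ([:-x, 1:] * g)" by (simp add: c'_def g_def)
    have "lead_coeff g = 1" using IH(1) by (simp add: c_def monic_coeff_def)
    then have c'0: "c' 0 = 1"
      unfolding c' monic_coeff_def by (simp only: diff_zero lead_coeff_mult zero_le if_True) simp
    have c'k: "c' (Suc k) = c (Suc k) - x * c k" for k
      unfolding c' c_def by (rule monic_coeff_linear_mult[OF g0])
    have cs: "c' 1 = c 1 - x" "c' 2 = c 2 - x * c 1" "c' 3 = c 3 - x * c 2" "c' 4 = c 4 - x * c 3"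
      using c'k[of 0] c'k[of 1] c'k[of 2] c'k[of 3] IH(1) by (simp_all add: numeral_eq_Suc)
    have "x ^ 2 + (u ^ 2 - 2 * v) = (u - x) ^ 2 - 2 * (v - x * u)" for u v
      by (simp add: algebra_simps power2_eq_square)
    moreover have "x ^ 4 + (u ^ 4 - 4 * u ^ 2 * v + 2 * v ^ 2 + 4 * u * w - 4 * z) =
        (u - x) ^ 4 - 4 * (u - x) ^ 2 * (v - x * u) + 2 * (v - x * u) ^ 2 + 4 * (u - x) * (w - x * v) - 4 * (z - x * w)"
      for u v w z
      by (simp add: power4_eq_xxxx power2_eq_square algebra_simps)
    moreover have "x + - u = - (u - x)" for u by simp
    ultimately have "c' 0 = 1 \<and> (\<Sum>x\<in>#add_mset x A. x) = - c' 1 \<and>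
      (\<Sum>x\<in>#add_mset x A. x ^ 2) = c' 1 ^ 2 - 2 * c' 2 \<and>
      (\<Sum>x\<in>#add_mset x A. x ^ 4) =
        c' 1 ^ 4 - 4 * c' 1 ^ 2 * c' 2 + 2 * c' 2 ^ 2 + 4 * c' 1 * c' 3 - 4 * c' 4"
      unfolding cs c'0 image_mset_add_mset sum_mset.add_mset IH(2-) by blast
    then show ?case unfolding Let_def c'_def .
  qed
  then show "c 0 = 1" "(\<Sum>x\<in>#A. x) = - c 1" "(\<Sum>x\<in>#A. x ^ 2) = c 1 ^ 2 - 2 * c 2"
    "(\<Sum>x\<in>#A. x ^ 4) = c 1 ^ 4 - 4 * c 1 ^ 2 * c 2 + 2 * c 2 ^ 2 + 4 * c 1 * c 3 - 4 * c 4"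
    unfolding c_def Let_def by auto
qed

section \<open>Characters of monic polynomials and their L-function\<close>

context subfield_of_closed
begin

text \<open>Counting roots with multiplicity makes this additive in \<open>g\<close>, so that
  \<open>poly_char\<close> is multiplicative without any coprimality condition, like a Dirichlet
  character.\<close>

definition root_sum :: "'k poly \<Rightarrow> 'k poly \<Rightarrow> 'k" where
  "root_sum f g = (\<Sum>x\<in>#proots g. poly f x)"

definition poly_char :: "'k poly \<Rightarrow> 'k poly \<Rightarrow> complex" where
  "poly_char f g = chi (Tr n (root_sum f g))"

definition exp_sum :: "'k poly \<Rightarrow> nat \<Rightarrow> complex" where
  "exp_sum f k = (\<Sum>x\<in>Fix (q ^ k). chi (Tr (n * k) (poly f x)))"

definition L_coeff :: "'k poly \<Rightarrow> nat \<Rightarrow> complex" where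
  "L_coeff f d = (\<Sum>g\<in>monics q d. poly_char f g)"

lemma proots_frob:
  fixes g :: "'k poly"
  assumes "g \<in> monics q d" shows "image_mset (\<lambda>x. x ^ q) (proots g) = proots g"
proof -
  have g: "lead_coeff g = 1" "conj_poly g = g" using assms by (auto simp: mem_monics)
  have "conj_poly g = (\<Prod>x\<in>#proots g. [:-(x ^ q), 1:])"
    by (subst monic_eq_prod_proots[OF g(1)]) (simp add: conj_poly_prod_mset conj_poly_linear)
  also have "\<dots> = (\<Prod>y\<in>#image_mset (\<lambda>x. x ^ q) (proots g). [:-y, 1:])"
    by (simp add: multiset.map_comp comp_def)
  finally have "proots g = proots (\<Prod>y\<in>#image_mset (\<lambda>x. x ^ q) (proots g). [:-y, 1:])"
    using g(2) by simp
  then show ?thesis unfolding proots_prod_linear by simp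
qed

lemma root_sum_in_Fix:
  assumes f: "conj_poly f = f" and g: "g \<in> monics q d"
  shows "root_sum f g \<in> Fix q"
proof -
  have sm: "sum_mset M ^ q = (\<Sum>z\<in>#M. z ^ q)" for M :: "'k multiset"
    using frob_q_add[of _ _ 1] by (induction M) (auto simp: q_0)
  have "root_sum f g ^ q = (\<Sum>x\<in>#proots g. poly f x ^ q)"
    unfolding root_sum_def sm by (simp add: multiset.map_comp comp_def)
  also have "\<dots> = (\<Sum>x\<in>#proots g. poly f (x ^ q))"
    using poly_frob[OF f, of _ 1] by simp
  also have "\<dots> = (\<Sum>x\<in>#image_mset (\<lambda>x. x ^ q) (proots g). poly f x)"
    by (simp add: multiset.map_comp comp_def)
  also have "\<dots> = root_sum f g" unfolding proots_frob[OF g] root_sum_def ..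
  finally show ?thesis by (simp add: fixed_pts_def)
qed

lemma Tr_n_in_Fix: "z \<in> Fix q \<Longrightarrow> Tr n z \<in> Fix p"
  unfolding q_def by (rule Tr_in_Fix)

lemma root_sum_mult: "g \<noteq> 0 \<Longrightarrow> h \<noteq> 0 \<Longrightarrow> root_sum f (g * h) = root_sum f g + root_sum f h"
  by (simp add: root_sum_def proots_mult)

lemma poly_char_mult:
  assumes f: "conj_poly f = f" and "g \<in> monics q d" "h \<in> monics q e"
  shows "poly_char f (g * h) = poly_char f g * poly_char f h"
  using assms
  by (simp add: poly_char_def root_sum_mult monics_neq_0 Tr_add chi_add Tr_n_in_Fix root_sum_in_Fix)

text \<open>Transitivity of the trace: for \<open>z\<close> in \<open>Fix (q ^ k)\<close> the inner
  sum is the relative trace to \<open>Fix q\<close>. It identifies the terms of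
  \<open>exp_sum\<close> with values of \<open>poly_char\<close> at orbit polynomials.\<close>

lemma Tr_tower: "Tr (n * k) z = Tr n (\<Sum>i<k. z ^ q ^ i)"
proof (induction k)
  case (Suc k)
  have "Tr (n * k + n) z = Tr (n * k) z + (\<Sum>i<n. z ^ p ^ (n * k + i))"
    unfolding abs_trace_def lessThan_atLeast0
    by (subst sum.atLeastLessThan_concat[of 0 "n * k" "n * k + n", symmetric])
      (auto simp: sum.atLeastLessThan_shift_0[of _ "n * k" "n * k + n"] comp_def)
  also have "(\<Sum>i<n. z ^ p ^ (n * k + i)) = Tr n (z ^ q ^ k)"
    unfolding abs_trace_def q_power by (simp add: power_add flip: power_mult)
  finally show ?case using Suc by (simp add: Tr_add add.commute)
qed (use Tr_diff[of n 0 0] in \<open>simp add: abs_trace_def\<close>)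

lemma poly_char_orbit_poly:
  assumes f: "conj_poly f = f"
  shows "poly_char f (orbit_poly q k x) = chi (Tr (n * k) (poly f x))"
proof -
  have "root_sum f (orbit_poly q k x) = (\<Sum>i<k. poly f (x ^ q ^ i))"
    unfolding root_sum_def proots_orbit_poly by (induction k) auto
  then show ?thesis by (simp add: poly_char_def Tr_tower poly_frob[OF f])
qed

text \<open>The logarithmic derivative of the L-function, coefficient by coefficient: every monic \<open>g\<close> of
  degree \<open>r\<close> factors in exactly \<open>r\<close> ways as an orbit polynomial times a monic polynomial.\<close>
lemma L_coeff_recurrence:
  assumes f: "conj_poly f = f"
  shows "of_nat r * L_coeff f r = (\<Sum>k\<in>{1..r}. exp_sum f k * L_coeff f (r - k))"
proof -
  let ?D = "\<lambda>k x. {g \<in> monics q r. orbit_poly q k x dvd g}"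
  \<comment> \<open>Multiplication by the orbit polynomial maps the monics of degree
    \<open>r - k\<close> bijectively onto its multiples of degree \<open>r\<close>.\<close>
  have step: "chi (Tr (n * k) (poly f x)) * L_coeff f (r - k) = (\<Sum>g\<in>?D k x. poly_char f g)"
    if k: "k \<in> {1..r}" and x: "x \<in> Fix (q ^ k)" for k x
  proof -
    have o: "orbit_poly q k x \<in> monics q k" by (rule orbit_poly_in_monics[OF x])
    have o0: "orbit_poly q k x \<noteq> 0" using monics_neq_0[OF o] .
    have "chi (Tr (n * k) (poly f x)) * L_coeff f (r - k) =
        (\<Sum>h\<in>monics q (r - k). poly_char f (orbit_poly q k x * h))"
      unfolding L_coeff_def sum_distrib_left
      by (intro sum.cong refl) (simp add: poly_char_mult[OF f o] poly_char_orbit_poly[OF f])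
    also have "\<dots> = (\<Sum>g\<in>?D k x. poly_char f g)"
    proof (rule sum.reindex_bij_betw)
      show "bij_betw (\<lambda>h. orbit_poly q k x * h) (monics q (r - k)) (?D k x)"
        unfolding bij_betw_def
      proof (intro conjI equalityI subsetI)
        show "inj_on (\<lambda>h. orbit_poly q k x * h) (monics q (r - k))"
          using o0 by (auto simp: inj_on_def)
      next
        fix g assume "g \<in> (\<lambda>h. orbit_poly q k x * h) ` monics q (r - k)"
        then obtain h where h: "g = orbit_poly q k x * h" "h \<in> monics q (r - k)" by blast
        have "degree g = k + (r - k)" unfolding h(1)
          using o h(2) o0 monics_neq_0[OF h(2)] by (subst degree_mult_eq) (auto simp: mem_monics)
        moreover have "lead_coeff h = 1" using h(2) unfolding mem_monics by blast
        then have "lead_coeff g = 1"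
          unfolding h(1) lead_coeff_mult by (simp only: orbit_poly_monic mult_1)
        moreover have "conj_poly g = g" unfolding h(1) conj_poly_mult
          using o h(2) by (simp only: mem_monics)
        ultimately show "g \<in> ?D k x" using k h(1) by (auto simp: mem_monics)
      next
        fix g assume g: "g \<in> ?D k x"
        then obtain h where h: "g = orbit_poly q k x * h" by (auto elim: dvdE)
        have g': "lead_coeff g = 1" "degree g = r" "conj_poly g = g" using g by (auto simp: mem_monics)
        have h0: "h \<noteq> 0" using g' h by auto
        have "lead_coeff h = 1"
          using g'(1) unfolding h lead_coeff_mult orbit_poly_monic mult_1 .
        moreover have "degree h = r - k"
          using g'(2) degree_mult_eq[OF o0 h0] orbit_poly_degree[of q k x] unfolding h by simp
        moreover have "conj_poly h = h"
        proof -
          have "orbit_poly q k x * conj_poly h = orbit_poly q k x * h"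
            using g'(3) o unfolding h conj_poly_mult by (simp only: mem_monics)
          then show ?thesis using o0 by (metis mult_left_cancel)
        qed
        ultimately show "g \<in> (\<lambda>h. orbit_poly q k x * h) ` monics q (r - k)"
          using h by (auto simp: mem_monics)
      qed
    qed
    finally show ?thesis .
  qed
  have finF: "finite (Fix (q ^ k))" if "k \<in> {1..r}" for k
    unfolding q_power using that n_pos by (intro Fix_finite_power) simp
  have "(\<Sum>k\<in>{1..r}. exp_sum f k * L_coeff f (r - k)) =
      (\<Sum>k\<in>{1..r}. \<Sum>x\<in>Fix (q ^ k). \<Sum>g\<in>?D k x. poly_char f g)"
    unfolding exp_sum_def sum_distrib_right by (intro sum.cong refl step)
  also have "\<dots> = (\<Sum>k\<in>{1..r}. \<Sum>x\<in>Fix (q ^ k). \<Sum>g\<in>monics q r.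
      if orbit_poly q k x dvd g then poly_char f g else 0)"
    by (simp only: sum.inter_filter[OF finite_monics])
  also have "\<dots> = (\<Sum>g\<in>monics q r. \<Sum>k\<in>{1..r}. \<Sum>x\<in>Fix (q ^ k).
      if orbit_poly q k x dvd g then poly_char f g else 0)"
    by (simp only: sum.swap[of _ "monics q r"])
  also have "\<dots> = (\<Sum>g\<in>monics q r. of_nat r * poly_char f g)"
  proof (intro sum.cong refl)
    fix g :: "'k poly" assume g: "g \<in> monics q r"
    have "(\<Sum>k\<in>{1..r}. \<Sum>x\<in>Fix (q ^ k). if orbit_poly q k x dvd g then poly_char f g else 0) =
      (\<Sum>k\<in>{1..r}. of_nat (card {x \<in> Fix (q ^ k). orbit_poly q k x dvd g}) * poly_char f g)"
      using finF by (intro sum.cong refl) (simp flip: sum.inter_filter)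
    also have "\<dots> = of_nat (\<Sum>k\<in>{1..r}. card {x \<in> Fix (q ^ k). orbit_poly q k x dvd g}) * poly_char f g"
      by (simp only: of_nat_sum sum_distrib_right)
    finally show "(\<Sum>k\<in>{1..r}. \<Sum>x\<in>Fix (q ^ k). if orbit_poly q k x dvd g then poly_char f g else 0) =
      of_nat r * poly_char f g" unfolding card_orbit_divisors[OF g] .
  qed
  finally show ?thesis by (simp add: L_coeff_def sum_distrib_left)
qed

lemma L_coeff_0: "L_coeff f 0 = 1"
  using Tr_diff[of n 0 0] by (simp add: L_coeff_def monics_0 poly_char_def root_sum_def)

text \<open>Only the four coefficients after the leading one enter, and \<open>c 4\<close> does so
  linearly with factor \<open>- 4 * b\<close>.\<close>

lemma root_sum_quartic:
  assumes g: "lead_coeff g = 1"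
  shows "root_sum [:0, 0, a, 0, b:] g = (let c = monic_coeff g in
    a * (c 1 ^ 2 - 2 * c 2) + b * (c 1 ^ 4 - 4 * c 1 ^ 2 * c 2 + 2 * c 2 ^ 2 + 4 * c 1 * c 3 - 4 * c 4))"
proof -
  have "root_sum [:0, 0, a, 0, b:] g = a * (\<Sum>x\<in>#proots g. x ^ 2) + b * (\<Sum>x\<in>#proots g. x ^ 4)"
  proof -
    have "poly [:0, 0, a, 0, b:] = (\<lambda>x. a * x ^ 2 + b * x ^ 4)"
      by (intro ext) (simp add: algebra_simps power2_eq_square power4_eq_xxxx)
    then show ?thesis unfolding root_sum_def by (simp only: sum_mset.distrib sum_mset_distrib_left)
  qed
  then show ?thesis
    unfolding power_sums_roots Let_def monic_eq_prod_proots[OF g, symmetric] .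
qed

text \<open>A shift of the fourth coefficient of \<open>g\<close> changes the root sum linearly, so the sum over all
  monic \<open>g\<close> contains a full nontrivial character sum.\<close>
lemma L_coeff_quartic_eq_0:
  assumes p2: "p \<noteq> 2" and a: "a \<in> Fix q" and b: "b \<in> Fix q" "b \<noteq> 0" and d: "d \<ge> 4"
  shows "L_coeff [:0, 0, a, 0, b:] d = 0"
proof -
  define f where "f = [:0, 0, a, 0, b:]"
  have f: "conj_poly f = f"
    unfolding conj_poly_eq_iff f_def using a b q_0 by (auto simp: coeff_pCons fixed_pts_def split: nat.split)
  have "\<not> p dvd 4"
  proof
    assume "p dvd 4"
    then have "p dvd 2 * 2" by simp
    then have "p dvd 2" using prime_p prime_dvd_mult_iff by blast
    then show False using p2 prime_p primes_dvd_imp_eq two_is_prime_nat by blast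
  qed
  then have four: "(4 :: 'k) \<noteq> 0" using of_nat_eq_0_iff_char_dvd[where 'a = 'k, of 4] char_p by simp
  obtain z where z: "z \<in> Fix q" "Tr n z \<noteq> 0" using Tr_nonzero_exists[OF n_pos] q_def by metis
  \<comment> \<open>Chosen so that shifting by \<open>u\<close> adds \<open>z\<close> to the root
    sum; the division by 4 is where \<open>p\<close> must be odd.\<close>
  define u where "u = - (z / (4 * b))"
  have "(4::'k) ^ q = 4"
    using Fix_power[of "4::'k" p n] of_nat_frob[of 4] by (simp add: fixed_pts_def q_def)
  then have "(z / (4 * b)) ^ q = z / (4 * b)" using z b
    by (simp add: fixed_pts_def power_divide power_mult_distrib)
  then have u: "u \<in> Fix q" using frob_minus[of "z / (4 * b)" n]
    unfolding u_def by (simp add: fixed_pts_def q_def)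
  have ub: "- 4 * b * u = z" using four b by (simp add: u_def)
  define sh where "sh = (\<lambda>w g. g + monom w (d - 4) :: 'k poly)"
  have shift: "sh w g \<in> monics q d" "root_sum f (sh w g) = root_sum f g - 4 * b * w"
    if g: "g \<in> monics q d" and w: "w \<in> Fix q" for g w
  proof -
    have dg: "degree g = d" "lead_coeff g = 1" "\<And>i. coeff g i \<in> Fix q" using g by (auto simp: monics_def)
    have "degree (monom w (d - 4)) < degree g"
      using d dg degree_monom_le[of w "d - 4"] by linarith
    then have ds: "degree (sh w g) = d" unfolding sh_def using dg by (simp add: degree_add_eq_left)
    have ls: "lead_coeff (sh w g) = 1" using dg d unfolding ds unfolding sh_def by simp
    have "coeff (sh w g) i ^ q = coeff (sh w g) i" for i
      using frob_q_add[of "coeff g i" "coeff (monom w (d - 4)) i" 1] dg(3)[of i] w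
      by (simp add: sh_def fixed_pts_def q_0)
    then show "sh w g \<in> monics q d" using ds ls by (simp add: monics_def fixed_pts_def)
    have mc: "monic_coeff (sh w g) k = monic_coeff g k + (if k = 4 then w else 0)" for k
      unfolding monic_coeff_def ds dg(1) using d by (auto simp: sh_def)
    show "root_sum f (sh w g) = root_sum f g - 4 * b * w"
      unfolding f_def root_sum_quartic[OF ls] root_sum_quartic[OF dg(2)] Let_def mc
      by (simp add: algebra_simps)
  qed
  have mu: "- u \<in> Fix q" using u frob_minus[of u n] by (simp add: fixed_pts_def q_def)
  have "L_coeff f d = (\<Sum>g\<in>monics q d. poly_char f (sh u g))"
    unfolding L_coeff_def using shift(1)[OF _ u] shift(1)[OF _ mu]
    by (intro sum.reindex_bij_witness[of _ "sh u" "sh (- u)"])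
      (auto simp: sh_def add.assoc add_monom)
  also have "\<dots> = (\<Sum>g\<in>monics q d. poly_char f g * chi (Tr n z))"
  proof (intro sum.cong refl)
    fix g :: "'k poly" assume g: "g \<in> monics q d"
    have "root_sum f (sh u g) = root_sum f g + z" unfolding shift(2)[OF g u] ub[symmetric] by simp
    then show "poly_char f (sh u g) = poly_char f g * chi (Tr n z)"
      by (simp add: poly_char_def Tr_add chi_add Tr_n_in_Fix root_sum_in_Fix[OF f g] z)
  qed
  also have "\<dots> = L_coeff f d * chi (Tr n z)" by (simp add: L_coeff_def sum_distrib_right)
  finally show ?thesis
    using chi_eq_1_iff[OF Tr_n_in_Fix[OF z(1)]] z(2) by (simp add: f_def)
qed

end

section \<open>The Weil bound\<close>

text \<open>Applying "index shift minus \<open>v\<close>" to the sequence of power sums, for each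
  value \<open>v\<close> other than \<open>\<mu> i\<close>, preserves boundedness and kills the
  terms with \<open>\<mu> j = v\<close>. There remains a nonzero multiple of
  \<open>\<mu> i ^ s\<close>, unbounded if the modulus exceeds 1.\<close>

lemma power_sums_bounded_imp_norm_le_1:
  fixes \<mu> :: "'i \<Rightarrow> complex"
  assumes fin: "finite I" and i: "i \<in> I"
    and bd: "\<And>s. s \<ge> s0 \<Longrightarrow> cmod (\<Sum>j\<in>I. \<mu> j ^ s) \<le> C"
  shows "cmod (\<mu> i) \<le> 1"
proof (rule ccontr)
  assume "\<not> cmod (\<mu> i) \<le> 1"
  then have gt: "cmod (\<mu> i) > 1" by simp
  have filt: "\<exists>C. \<forall>s\<ge>s0. cmod (\<Sum>j\<in>I. (\<Prod>v\<in>V. \<mu> j - v) * \<mu> j ^ s) \<le> C" if "finite V" for V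
    using that
  proof (induction V)
    case empty
    then show ?case using bd by auto
  next
    case (insert v V)
    then obtain D where D: "\<And>s. s \<ge> s0 \<Longrightarrow> cmod (\<Sum>j\<in>I. (\<Prod>v\<in>V. \<mu> j - v) * \<mu> j ^ s) \<le> D" by blast
    show ?case
    proof (intro exI[of _ "D + cmod v * D"] allI impI)
      fix s assume s: "s \<ge> s0"
      have "(\<Sum>j\<in>I. (\<Prod>v\<in>insert v V. \<mu> j - v) * \<mu> j ^ s) =
          (\<Sum>j\<in>I. (\<Prod>v\<in>V. \<mu> j - v) * \<mu> j ^ Suc s) - v * (\<Sum>j\<in>I. (\<Prod>v\<in>V. \<mu> j - v) * \<mu> j ^ s)"
        unfolding sum_distrib_left sum_subtractf[symmetric] using insert.hyps
        by (intro sum.cong refl) (simp add: algebra_simps)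
      also have "cmod \<dots> \<le> cmod (\<Sum>j\<in>I. (\<Prod>v\<in>V. \<mu> j - v) * \<mu> j ^ Suc s) +
          cmod v * cmod (\<Sum>j\<in>I. (\<Prod>v\<in>V. \<mu> j - v) * \<mu> j ^ s)"
        by (rule order_trans[OF norm_triangle_ineq4]) (simp only: norm_mult order_refl)
      also have "\<dots> \<le> D + cmod v * D"
        using s by (intro add_mono mult_left_mono D) auto
      finally show "cmod (\<Sum>j\<in>I. (\<Prod>v\<in>insert v V. \<mu> j - v) * \<mu> j ^ s) \<le> D + cmod v * D" .
    qed
  qed
  define V where "V = \<mu> ` I - {\<mu> i}"
  have V: "finite V" using fin by (simp add: V_def)
  obtain D where D: "\<And>s. s \<ge> s0 \<Longrightarrow> cmod (\<Sum>j\<in>I. (\<Prod>v\<in>V. \<mu> j - v) * \<mu> j ^ s) \<le> D"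
    using filt[OF V] by blast
  \<comment> \<open>Indices sharing the value \<open>\<mu> i\<close> reinforce each other with
    weight \<open>card J\<close> and cannot cancel.\<close>
  define J where "J = {j \<in> I. \<mu> j = \<mu> i}"
  define w where "w = of_nat (card J) * (\<Prod>v\<in>V. \<mu> i - v)"
  have "card J > 0" using fin i by (auto simp: J_def card_gt_0_iff)
  then have w: "cmod w > 0" using V by (auto simp: w_def V_def)
  have e: "(\<Sum>j\<in>I. (\<Prod>v\<in>V. \<mu> j - v) * \<mu> j ^ s) = w * \<mu> i ^ s" for s
  proof -
    have "(\<Sum>j\<in>I. (\<Prod>v\<in>V. \<mu> j - v) * \<mu> j ^ s) = (\<Sum>j\<in>J. (\<Prod>v\<in>V. \<mu> j - v) * \<mu> j ^ s)"
    proof (rule sum.mono_neutral_right[OF fin])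
      show "\<forall>j\<in>I - J. (\<Prod>v\<in>V. \<mu> j - v) * \<mu> j ^ s = 0"
      proof
        fix j assume "j \<in> I - J"
        then have "\<mu> j \<in> V" by (auto simp: V_def J_def)
        then have "(\<Prod>v\<in>V. \<mu> j - v) = 0" using V by (intro prod_zero) auto
        then show "(\<Prod>v\<in>V. \<mu> j - v) * \<mu> j ^ s = 0" by simp
      qed
    qed (auto simp: J_def)
    also have "\<dots> = (\<Sum>j\<in>J. (\<Prod>v\<in>V. \<mu> i - v) * \<mu> i ^ s)"
      by (intro sum.cong) (auto simp: J_def)
    finally show ?thesis by (simp add: w_def)
  qed
  obtain m where m: "D / cmod w < cmod (\<mu> i) ^ m" using real_arch_pow[OF gt] by blast
  then have "D < cmod w * cmod (\<mu> i) ^ m" using w by (simp add: divide_less_eq mult.commute)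
  also have "\<dots> \<le> cmod w * cmod (\<mu> i) ^ (m + s0)"
    using gt by (intro mult_left_mono power_increasing) auto
  also have "\<dots> \<le> D"
    using D[of "m + s0"] unfolding e by (simp add: norm_mult norm_power)
  finally show False by simp
qed

section \<open>From the inverse roots of the L-function to the Weil bound\<close>

context subfield_of_closed
begin

lemma exp_sum_eq_power_sums:
  assumes f: "conj_poly f = f" and L: "\<And>d. d \<ge> 4 \<Longrightarrow> L_coeff f d = 0"
  obtains x y z where "\<And>k. k \<ge> 1 \<Longrightarrow> exp_sum f k = - (x ^ k + y ^ k + z ^ k)"
proof -
  define c where "c = L_coeff f"
  \<comment> \<open>The L-polynomial with reversed coefficients, so \<open>x\<close>,
    \<open>y\<close>, \<open>z\<close> are its inverse roots; a lower degree merely makes some of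
    them 0.\<close>
  define G where "G = [:c 3, c 2, c 1, 1:]"
  have "G \<noteq> 0" "degree G = 3" "lead_coeff G = 1" by (auto simp: G_def)
  then obtain A where A: "size A = 3" "G = (\<Prod>x\<in>#A. [:-x, 1:])"
    using alg_closed_imp_factorization[of G] by auto
  then obtain x B where xB: "A = add_mset x B" "size B = 2"
    by (metis size_eq_Suc_imp_eq_union size_add_mset add_left_imp_eq plus_1_eq_Suc numeral_3_eq_3 numeral_2_eq_2 nat.inject add_mset_add_single)
  then obtain y D where yD: "B = add_mset y D" "size D = 1"
    by (metis size_eq_Suc_imp_eq_union size_add_mset numeral_2_eq_2 nat.inject One_nat_def)
  then obtain z where z: "D = {#z#}" by (metis size_1_singleton_mset)
  have G: "G = [:-x, 1:] * ([:-y, 1:] * [:-z, 1:])" using A xB yD z by simp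
  have c: "c 1 = - (x + y + z)" "c 2 = x * y + y * z + x * z" "c 3 = - (x * y * z)"
    using G unfolding G_def by (simp_all add: algebra_simps)
  have c0: "c 0 = 1" by (simp add: c_def L_coeff_0)
  have c4: "c d = 0" if "d \<ge> 4" for d using L[OF that] by (simp add: c_def)
  have rec: "of_nat r * c r = (\<Sum>k\<in>{1..r}. exp_sum f k * c (r - k))" for r
    unfolding c_def by (rule L_coeff_recurrence[OF f])
  have S1: "exp_sum f 1 = - (x + y + z)"
    using rec[of 1] c c0 by simp
  have S2: "exp_sum f 2 = - (x ^ 2 + y ^ 2 + z ^ 2)"
  proof -
    have "{1..2} = {1, 2 :: nat}" by auto
    then have "2 * c 2 = exp_sum f 1 * c 1 + exp_sum f 2" using rec[of 2] c0 by simp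
    then have "exp_sum f 2 = 2 * c 2 - exp_sum f 1 * c 1" by (simp add: algebra_simps)
    then show ?thesis unfolding S1 c by (simp add: algebra_simps power2_eq_square)
  qed
  have S3: "exp_sum f 3 = - (x ^ 3 + y ^ 3 + z ^ 3)"
  proof -
    have "{1..3} = {1, 2, 3 :: nat}" by auto
    then have "3 * c 3 = exp_sum f 1 * c 2 + (exp_sum f 2 * c 1 + exp_sum f 3)"
      using rec[of 3] c0 by (simp add: numeral_eq_Suc)
    then have "exp_sum f 3 = 3 * c 3 - exp_sum f 1 * c 2 - exp_sum f 2 * c 1" by (simp add: algebra_simps)
    then show ?thesis unfolding S1 S2 c by (simp add: algebra_simps power2_eq_square power3_eq_cube)
  qed
  \<comment> \<open>For \<open>r = m + 4\<close> the left side of \<open>rec\<close> vanishes and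
    only the last four terms survive: a linear recurrence with characteristic polynomial
    \<open>G\<close>.\<close>
  have S4: "exp_sum f (m + 4) = - (c 1 * exp_sum f (m + 3) + c 2 * exp_sum f (m + 2) + c 3 * exp_sum f (m + 1))" for m
  proof -
    have s: "{1..m + 4} = {1..m} \<union> {m + 1, m + 2, m + 3, m + 4}" by auto
    have "(\<Sum>k\<in>{1..m + 4}. exp_sum f k * c (m + 4 - k)) =
        (\<Sum>k\<in>{m + 1, m + 2, m + 3, m + 4}. exp_sum f k * c (m + 4 - k))"
      unfolding s by (rule sum.mono_neutral_right) (auto simp: c4)
    also have "\<dots> = exp_sum f (m + 1) * c 3 + (exp_sum f (m + 2) * c 2 + (exp_sum f (m + 3) * c 1 + exp_sum f (m + 4)))"
      using c0 by (simp add: numeral_eq_Suc)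
    finally have "exp_sum f (m + 1) * c 3 + (exp_sum f (m + 2) * c 2 + (exp_sum f (m + 3) * c 1 + exp_sum f (m + 4))) = 0"
      using rec[of "m + 4"] c4[of "m + 4"] by simp
    then have "exp_sum f (m + 4) + (c 1 * exp_sum f (m + 3) + c 2 * exp_sum f (m + 2) + c 3 * exp_sum f (m + 1)) = 0"
      by (simp add: algebra_simps)
    then show ?thesis by (simp only: eq_neg_iff_add_eq_0)
  qed
  have "exp_sum f k = - (x ^ k + y ^ k + z ^ k)" if "k \<ge> 1" for k
    using that
  proof (induction k rule: less_induct)
    case (less k)
    show ?case
    proof (cases "k \<ge> 4")
      case True
      then obtain m where m: "k = m + 4" by (metis add.commute le_Suc_ex)
      have IH: "exp_sum f (m + i) = - (x ^ (m + i) + y ^ (m + i) + z ^ (m + i))" if "i \<in> {1, 2, 3}" for i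
        using that less.IH[of "m + i"] by (auto simp: m)
      have IHs: "exp_sum f (m + 1) = - (x ^ (m + 1) + y ^ (m + 1) + z ^ (m + 1))"
        "exp_sum f (m + 2) = - (x ^ (m + 2) + y ^ (m + 2) + z ^ (m + 2))"
        "exp_sum f (m + 3) = - (x ^ (m + 3) + y ^ (m + 3) + z ^ (m + 3))"
        by (rule IH; simp)+
      show ?thesis unfolding m S4 IHs c
        by (simp add: algebra_simps power_add power2_eq_square power3_eq_cube power4_eq_xxxx)
    next
      case False
      then consider "k = 1" | "k = 2" | "k = 3" using less.prems by linarith
      then show ?thesis using S1 S2 S3 by cases auto
    qed
  qed
  then show thesis by (rule that)
qed

text \<open>The constant \<open>2 * c + 1\<close> from the Stepanov bound is independent of the
  extension degree, so it disappears in the limit and each inverse root contributes one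
  \<open>sqrt q\<close>.\<close>

lemma quartic_weil_bound:
  assumes p2: "p \<noteq> 2" and a: "a \<in> Fix q" and b: "b \<in> Fix q" "b \<noteq> 0"
  shows "cmod (\<Sum>x\<in>Fix q. chi (Tr n (a * x ^ 2 + b * x ^ 4))) \<le> 3 * sqrt (real q)"
proof -
  define f where "f = [:0, 0, a, 0, b:]"
  have f: "conj_poly f = f"
    unfolding conj_poly_eq_iff f_def using a b q_0 by (auto simp: coeff_pCons fixed_pts_def split: nat.split)
  have pf: "poly f x = a * x ^ 2 + b * x ^ 4" for x
    by (simp add: f_def algebra_simps power2_eq_square power4_eq_xxxx)
  have df: "degree f = 4" using b by (simp add: f_def)
  obtain x y z where S: "\<And>k. k \<ge> 1 \<Longrightarrow> exp_sum f k = - (x ^ k + y ^ k + z ^ k)"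
    using exp_sum_eq_power_sums[OF f] L_coeff_quartic_eq_0[OF p2 a b] unfolding f_def by metis
  define c where "c = p * degree f"
  \<comment> \<open>From here on \<open>p ^ (n * k)\<close> exceeds the Stepanov threshold, because
    \<open>k < 2 ^ k\<close> and \<open>q\<close> is at least 2.\<close>
  define k0 where "k0 = c * c + 3 * c + 1"
  have "\<not> p dvd 2" using p2 prime_p primes_dvd_imp_eq two_is_prime_nat by blast
  then have "coprime p 2" using prime_p prime_imp_coprime by blast
  then have cop: "coprime p (degree f)"
    using coprime_mult_right_iff[of p 2 2] unfolding df by simp
  have q0: "real q > 0" using q_gt_1 by simp
  have bd: "cmod (x ^ (2 * k) + y ^ (2 * k) + z ^ (2 * k)) \<le> real (2 * c + 1) * real q ^ k" if k: "k \<ge> k0" for k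
  proof -
    have k1: "2 * k \<ge> 1" using k by (simp add: k0_def)
    have "k < 2 ^ k" by (rule less_exp)
    also have "(2 :: nat) ^ k \<le> q ^ k" using q_gt_1 by (intro power_mono) auto
    also have "q ^ k = p ^ (n * k)" by (rule q_power)
    finally have big: "c * c + 3 * c + 1 < p ^ (n * k)" using k by (simp add: k0_def)
    have q2: "q ^ (2 * k) = p ^ (2 * (n * k))" unfolding q_power by (simp add: mult_ac)
    have "cmod (x ^ (2 * k) + y ^ (2 * k) + z ^ (2 * k)) = cmod (exp_sum f (2 * k))"
      unfolding S[OF k1] by (rule norm_minus_cancel[symmetric])
    also have "exp_sum f (2 * k) = (\<Sum>x\<in>Fix (p ^ (2 * (n * k))). chi (Tr (2 * (n * k)) (poly f x)))"
      unfolding exp_sum_def q2 by (simp add: mult_ac)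
    also have "cmod \<dots> \<le> real (2 * c + 1) * real p ^ (n * k)"
    proof (rule stepanov_sum_bound[OF cop _ c_def big])
      show "degree f > 0" by (simp add: df)
      fix x :: 'k assume "x \<in> Fix (p ^ (2 * (n * k)))"
      then show "poly f x \<in> Fix (p ^ (2 * (n * k)))"
        unfolding q2[symmetric] fixed_pts_def using poly_frob[OF f, of x "2 * k"] by simp
    qed
    also have "real p ^ (n * k) = real q ^ k" by (metis of_nat_power q_power)
    finally show ?thesis .
  qed
  define lam where "lam = (\<lambda>i :: nat. if i = 0 then x else if i = 1 then y else z)"
  have le: "cmod (lam i) \<le> sqrt (real q)" if "i < 3" for i
  proof -
    \<comment> \<open>Squares appear because only extensions of even degree are bounded; dividing by
      \<open>q\<close> makes their power sums bounded.\<close>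
    have "cmod (lam i ^ 2 / of_nat q) \<le> 1"
    proof (rule power_sums_bounded_imp_norm_le_1[where I = "{..<3}" and \<mu> = "\<lambda>i. lam i ^ 2 / of_nat q"
        and ?s0.0 = k0 and C = "real (2 * c + 1)"])
      fix k assume k: "k \<ge> k0"
      have "(\<Sum>j<3. (lam j ^ 2 / of_nat q) ^ k) = (x ^ (2 * k) + y ^ (2 * k) + z ^ (2 * k)) / of_nat q ^ k"
        by (simp add: numeral_3_eq_3 lam_def power_divide add_divide_distrib flip: power_mult)
      then have "cmod (\<Sum>j<3. (lam j ^ 2 / of_nat q) ^ k) = cmod (x ^ (2 * k) + y ^ (2 * k) + z ^ (2 * k)) / real q ^ k"
        by (simp add: norm_divide norm_power)
      then show "cmod (\<Sum>j<3. (lam j ^ 2 / of_nat q) ^ k) \<le> real (2 * c + 1)"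
        using bd[OF k] q0 by (simp add: divide_le_eq)
    qed (use that in auto)
    then have "cmod (lam i) ^ 2 \<le> real q"
      using q0 by (simp add: norm_divide norm_power divide_le_eq)
    then show ?thesis by (rule real_le_rsqrt)
  qed
  have "(\<Sum>x\<in>Fix q. chi (Tr n (a * x ^ 2 + b * x ^ 4))) = exp_sum f 1"
    by (simp add: exp_sum_def pf)
  also have "\<dots> = - (x + y + z)" using S[of 1] by simp
  also have "cmod \<dots> \<le> cmod x + cmod y + cmod z"
    unfolding norm_minus_cancel by (meson norm_triangle_ineq norm_triangle_le add_right_mono order_trans)
  also have "\<dots> \<le> 3 * sqrt (real q)"
    using le[of 0] le[of 1] le[of 2] by (simp add: lam_def)
  finally show ?thesis .
qed

end

section \<open>The correlation bound\<close>

lemma CHAR_finite_field: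
  assumes "prime p" "card (UNIV :: 'a::finite_field set) = p ^ n"
  shows "CHAR('a) = p"
proof -
  have "CHAR('a) dvd p ^ n" using CHAR_dvd_CARD[where 'a = 'a] assms(2) by simp
  moreover have "prime CHAR('a)" by simp
  ultimately show ?thesis using assms(1) prime_dvd_power primes_dvd_imp_eq by blast
qed

context

  \<comment> \<open>Transfer from a finite field to its algebraic closure\<close>
  fixes p n q :: nat and TYP :: "'a::finite_field itself"
  assumes p: "prime p" and n: "n > 0" and q: "q = p ^ n" and card: "card (UNIV :: 'a set) = q"
begin

interpretation closure: subfield_of_closed p "TYPE('a alg_closure)" n q
proof
  show "CHAR('a alg_closure) = p" using CHAR_finite_field[OF p] card q by simp
qed (use p n q in auto)

lemma to_ac_field_trace: "to_ac (field_trace p n (z :: 'a)) = abs_trace p n (to_ac z)"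
  by (simp add: field_trace_def abs_trace_def to_ac_sum)

lemma omega_pow_to_ac: "omega_pow p (z :: 'a) = prime_char p (to_ac z)"
proof -
  have "of_nat r = to_ac z \<longleftrightarrow> of_nat r = z" for r
    using to_ac_eq_iff[of "of_nat r" z] by simp
  then show ?thesis by (simp add: omega_pow_def prime_char_def residue_rep_def)
qed

lemma range_to_ac: "range (to_ac :: 'a \<Rightarrow> 'a alg_closure) = fixed_pts q"
proof -
  have "range (to_ac :: 'a \<Rightarrow> 'a alg_closure) \<subseteq> fixed_pts q"
    using finite_field_power_card_eq_same[where 'a = 'a] card
    by (auto simp: fixed_pts_def simp flip: to_ac_power)
  moreover have "card (range (to_ac :: 'a \<Rightarrow> 'a alg_closure)) = q"
    using card by (simp add: card_image inj_to_ac)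
  ultimately show ?thesis
    using closure.finite_Fix_q closure.card_Fix[OF n] q by (intro card_subset_eq) auto
qed

lemma field_trace_add: "field_trace p n (x + y :: 'a) = field_trace p n x + field_trace p n y"
  using closure.Tr_add[of n "to_ac x" "to_ac y"] to_ac_eq_iff
  by (simp flip: to_ac_field_trace to_ac_add)

lemma field_trace_diff: "field_trace p n (x - y :: 'a) = field_trace p n x - field_trace p n y"
  using field_trace_add[of "x - y" y] by (simp add: algebra_simps)

lemma finite_field_quartic_weil_bound:
  fixes a b :: 'a
  assumes "p \<noteq> 2" "b \<noteq> 0"
  shows "cmod (\<Sum>x\<in>UNIV. omega_pow p (field_trace p n (a * x ^ 2 + b * x ^ 4))) \<le> 3 * sqrt (real q)"
proof -
  have mem: "to_ac z \<in> fixed_pts q" for z :: 'a using range_to_ac by blast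
  have "(\<Sum>x\<in>UNIV. omega_pow p (field_trace p n (a * x ^ 2 + b * x ^ 4))) =
      (\<Sum>x\<in>UNIV. prime_char p (abs_trace p n (to_ac a * to_ac x ^ 2 + to_ac b * to_ac x ^ 4)))"
    by (simp add: omega_pow_to_ac to_ac_field_trace)
  also have "\<dots> = (\<Sum>x\<in>range to_ac. prime_char p (abs_trace p n (to_ac a * x ^ 2 + to_ac b * x ^ 4)))"
    by (simp add: sum.reindex[OF inj_to_ac] comp_def)
  also have "cmod \<dots> \<le> 3 * sqrt (real q)"
    unfolding range_to_ac using assms mem by (intro closure.quartic_weil_bound) auto
  finally show ?thesis .
qed

context

  \<comment> \<open>Powers of a primitive element\<close>
  fixes \<alpha> :: 'a and N :: nat
  assumes prim: "primitive_element \<alpha>" and N: "q = 2 * N + 1" and N_odd: "odd N"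
begin

lemma primitive_power_eq_1: "\<alpha> ^ (2 * N) = 1"
proof -
  have "\<alpha> * \<alpha> ^ (2 * N) = \<alpha> * 1"
    using finite_field_power_card_eq_same[of \<alpha>] card N by simp
  then show ?thesis using prim by (simp add: primitive_element_def)
qed

lemma primitive_power_mod: "\<alpha> ^ (k mod (2 * N)) = \<alpha> ^ k"
proof -
  have "\<alpha> ^ k = \<alpha> ^ (2 * N * (k div (2 * N)) + k mod (2 * N))" by (simp only: mult_div_mod_eq)
  then show ?thesis by (simp only: power_add power_mult[of _ "2 * N"] primitive_power_eq_1 power_one mult_1_left)
qed

lemma primitive_power_bij: "bij_betw (\<lambda>k. \<alpha> ^ k) {..<2 * N} (UNIV - {0})"
proof -
  have N0: "2 * N > 0" using N_odd by (auto elim: oddE)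
  have "(\<lambda>k. \<alpha> ^ k) ` {..<2 * N} = UNIV - {0}"
  proof (intro equalityI subsetI)
    fix x assume "x \<in> UNIV - {0 :: 'a}"
    then obtain k where "x = \<alpha> ^ k" using prim by (auto simp: primitive_element_def)
    then have "x = \<alpha> ^ (k mod (2 * N))" by (simp only: primitive_power_mod)
    then show "x \<in> (\<lambda>k. \<alpha> ^ k) ` {..<2 * N}" using N0 by (intro image_eqI[of _ _ "k mod (2 * N)"]) auto
  qed (use prim in \<open>auto simp: primitive_element_def\<close>)
  moreover have "card (UNIV - {0 :: 'a}) = 2 * N" using card N by (simp add: card_Diff_singleton)
  ultimately show ?thesis by (simp add: bij_betw_def eq_card_imp_inj_on)
qed

lemma primitive_power_eq_iff: "\<alpha> ^ k = \<alpha> ^ l \<longleftrightarrow> k mod (2 * N) = l mod (2 * N)"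
proof
  assume "\<alpha> ^ k = \<alpha> ^ l"
  then have "\<alpha> ^ (k mod (2 * N)) = \<alpha> ^ (l mod (2 * N))" by (simp only: primitive_power_mod)
  moreover have "2 * N > 0" using N_odd by (auto elim: oddE)
  ultimately show "k mod (2 * N) = l mod (2 * N)"
    using primitive_power_bij by (auto simp: bij_betw_def inj_on_def)
qed (metis primitive_power_mod)

text \<open>In \<open>\<alpha> ^ (2 * t)\<close> the exponent \<open>t\<close> matters only modulo
  the odd number \<open>N\<close>, where 2 is invertible: squaring permutes the nonzero
  squares.\<close>

lemma double_mod_inj: "inj_on (\<lambda>t. 2 * t mod N) {..<N}"
proof (rule inj_onI)
  fix s t assume st: "s \<in> {..<N}" "t \<in> {..<N}" "2 * s mod N = 2 * t mod N"
  then have "[2 * s = 2 * t] (mod N)" by (simp add: cong_def)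
  then have "[s = t] (mod N)" using N_odd cong_mult_lcancel_nat[of 2 N] by simp
  then show "s = t" using st by (simp add: cong_def)
qed

lemma primitive_double_mod: "\<alpha> ^ (2 * (2 * t mod N)) = \<alpha> ^ (4 * t)"
  using primitive_power_mod[of "4 * t"] mult_mod_right[of 2 "2 * t" N] by simp

lemma sum_squares_eq_sum_fourth_powers:
  "(\<Sum>t<N. h (\<alpha> ^ (2 * t))) = (\<Sum>t<N. h (\<alpha> ^ (4 * t)))"
proof -
  have "(\<lambda>t. 2 * t mod N) ` {..<N} = {..<N}"
    using double_mod_inj N_odd by (intro endo_inj_surj) (auto elim: oddE)
  then have "bij_betw (\<lambda>t. 2 * t mod N) {..<N} {..<N}" using double_mod_inj by (simp add: bij_betw_def)
  then have "(\<Sum>t<N. h (\<alpha> ^ (2 * t))) = (\<Sum>t<N. h (\<alpha> ^ (2 * (2 * t mod N))))"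
    by (rule sum.reindex_bij_betw[symmetric])
  then show ?thesis by (simp only: primitive_double_mod)
qed

text \<open>The exponents \<open>t\<close> and \<open>N + t\<close> give the same square, so each
  nonzero square is hit twice.\<close>

lemma sum_over_squares:
  fixes h :: "'a \<Rightarrow> complex"
  shows "(\<Sum>x\<in>UNIV. h (x ^ 2)) = h 0 + 2 * (\<Sum>t<N. h (\<alpha> ^ (2 * t)))"
proof -
  have shift: "\<alpha> ^ (2 * (N + t)) = \<alpha> ^ (2 * t)" for t
    by (simp add: distrib_left power_add primitive_power_eq_1 del: mult_numeral_left)
  have split: "(\<Sum>k<M + L. g k) = (\<Sum>k<M. g k) + (\<Sum>k<L. g (M + k))"
    for g :: "nat \<Rightarrow> complex" and M L
    by (induction L) (simp_all add: add.assoc)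
  have "(\<Sum>x\<in>UNIV. h (x ^ 2)) = h 0 + (\<Sum>x\<in>UNIV - {0}. h (x ^ 2))"
    using sum.remove[of UNIV "0::'a" "\<lambda>x. h (x ^ 2)"] by simp
  also have "(\<Sum>x\<in>UNIV - {0}. h (x ^ 2)) = (\<Sum>k<2 * N. h ((\<alpha> ^ k) ^ 2))"
    by (rule sum.reindex_bij_betw[OF primitive_power_bij, symmetric])
  also have "\<dots> = (\<Sum>k<N + N. h (\<alpha> ^ (2 * k)))"
    by (simp only: mult_2[of N] power_mult[symmetric] mult.commute[of _ 2])
  also have "\<dots> = (\<Sum>k<N. h (\<alpha> ^ (2 * k))) + (\<Sum>k<N. h (\<alpha> ^ (2 * (N + k))))"
    by (rule split)
  also have "\<dots> = 2 * (\<Sum>t<N. h (\<alpha> ^ (2 * t)))" unfolding shift by simp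
  finally show ?thesis .
qed

lemma half_sum_bound:
  assumes p2: "p \<noteq> 2" and ab: "a \<noteq> 0 \<or> b \<noteq> (0 :: 'a)"
  shows "cmod (\<Sum>t<N. omega_pow p (field_trace p n (a * \<alpha> ^ (2 * t) + b * \<alpha> ^ (4 * t)))) \<le>
    (3 * sqrt (real q) + 1) / 2"
proof -
  have main: "cmod (\<Sum>t<N. omega_pow p (field_trace p n (a * \<alpha> ^ (2 * t) + b * \<alpha> ^ (4 * t)))) \<le>
      (3 * sqrt (real q) + 1) / 2" if b: "b \<noteq> 0" for a b
  proof -
    define h where "h = (\<lambda>y. omega_pow p (field_trace p n (a * y + b * y ^ 2)))"
    have h0: "h 0 = 1"
      using field_trace_diff[of 0 0] by (simp add: h_def omega_pow_to_ac)
    have pw: "(x ^ 2) ^ 2 = x ^ 4" for x :: 'a by (simp flip: power_mult)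
    have pw': "(\<alpha> ^ (2 * t)) ^ 2 = \<alpha> ^ (4 * t)" for t by (simp add: mult.commute flip: power_mult)
    have W: "cmod (\<Sum>x\<in>UNIV. h (x ^ 2)) \<le> 3 * sqrt (real q)"
      unfolding h_def pw by (rule finite_field_quartic_weil_bound[OF p2 b])
    have "2 * (\<Sum>t<N. h (\<alpha> ^ (2 * t))) = (\<Sum>x\<in>UNIV. h (x ^ 2)) - 1"
      unfolding sum_over_squares h0 by simp
    then have "cmod (2 * (\<Sum>t<N. h (\<alpha> ^ (2 * t)))) \<le> 3 * sqrt (real q) + 1"
      using norm_triangle_ineq4[of "\<Sum>x\<in>UNIV. h (x ^ 2)" 1] W by simp
    then have "cmod (\<Sum>t<N. h (\<alpha> ^ (2 * t))) \<le> (3 * sqrt (real q) + 1) / 2"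
      by (simp add: norm_mult)
    then show ?thesis by (simp only: h_def pw')
  qed
  show ?thesis
  proof (cases "b = 0")
    case True
    \<comment> \<open>Passing from squares to fourth powers makes \<open>a\<close> the quartic
      coefficient, so \<open>main\<close> applies with quadratic coefficient 0.\<close>
    then show ?thesis
      using main[of a 0] ab sum_squares_eq_sum_fourth_powers[of "\<lambda>y. omega_pow p (field_trace p n (a * y))"] 
      by simp
  qed (rule main)
qed

text \<open>Exponents are compared modulo \<open>2 * N\<close>. The first equation gives
  \<open>i1 = 2 * \<tau> + i2\<close>, and \<open>i1\<close> is at most 1, so
  \<open>\<tau> = 0\<close>. In the second, parity gives \<open>j1 = j2\<close> and injectivity of
  doubling modulo \<open>N\<close> gives \<open>l1 = l2\<close>.\<close>

lemma nontrivial_parameters: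
  fixes \<beta> :: 'a
  assumes \<beta>: "\<beta> \<noteq> 0" and i: "i1 \<in> {0, 1}" "i2 \<in> {0, 1}" and j: "j1 \<in> {0, 1}" "j2 \<in> {0, 1}"
    and l: "l1 < N" "l2 < N" "\<tau> < N"
    and a: "\<beta> * (\<alpha> ^ i1 - \<alpha> ^ (2 * \<tau> + i2)) = 0"
    and b: "\<beta> * (\<alpha> ^ (4 * l1 + j1) - \<alpha> ^ (4 * \<tau> + 4 * l2 + j2)) = 0"
  shows "\<tau> = 0 \<and> i1 = i2 \<and> j1 = j2 \<and> l1 = l2"
proof -
  have "\<alpha> ^ i1 = \<alpha> ^ (2 * \<tau> + i2)" using a \<beta> by simp
  then have "i1 mod (2 * N) = (2 * \<tau> + i2) mod (2 * N)" by (simp only: primitive_power_eq_iff)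
  moreover have "i1 < 2 * N" "2 * \<tau> + i2 < 2 * N" using i l by auto
  ultimately have "i1 = 2 * \<tau> + i2" by simp
  then have \<tau>: "\<tau> = 0" "i1 = i2" using i by auto
  have "\<alpha> ^ (4 * l1 + j1) = \<alpha> ^ (4 * l2 + j2)" using b \<beta> \<tau> by simp
  then have m: "(4 * l1 + j1) mod (2 * N) = (4 * l2 + j2) mod (2 * N)" by (simp only: primitive_power_eq_iff)
  then have "(4 * l1 + j1) mod (2 * N) mod 2 = (4 * l2 + j2) mod (2 * N) mod 2" by simp
  then have "(4 * l1 + j1) mod 2 = (4 * l2 + j2) mod 2" by (simp only: mod_mod_cancel dvd_triv_left)
  then have "j1 mod 2 = j2 mod 2" by presburger
  then have jj: "j1 = j2" using j by auto
  then have "\<alpha> ^ (4 * l1) = \<alpha> ^ (4 * l2)"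
    using \<open>\<alpha> ^ (4 * l1 + j1) = \<alpha> ^ (4 * l2 + j2)\<close> prim by (simp add: power_add primitive_element_def)
  then have "\<alpha> ^ (2 * (2 * l1 mod N)) = \<alpha> ^ (2 * (2 * l2 mod N))" unfolding primitive_double_mod .
  then have "2 * (2 * l1 mod N) mod (2 * N) = 2 * (2 * l2 mod N) mod (2 * N)"
    by (simp only: primitive_power_eq_iff)
  then have "2 * (2 * l1 mod N mod N) = 2 * (2 * l2 mod N mod N)" by (simp only: mult_mod_right)
  then have "2 * l1 mod N = 2 * l2 mod N" by (metis mod_mod_trivial mult_left_cancel zero_neq_numeral)
  then have "l1 = l2" by (rule inj_onD[OF double_mod_inj]) (use l in simp_all)
  with \<tau> jj show ?thesis by simp
qed

end

end

theorem theorem6: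
  fixes p n q N d :: nat
    and \<alpha> \<beta> :: "'a::finite_field"
    and m :: "nat \<Rightarrow> 'a"
    and s :: "nat \<Rightarrow> nat \<Rightarrow> nat \<Rightarrow> nat \<Rightarrow> 'a"
    and S :: "(nat \<Rightarrow> 'a) set"
  assumes "prime p" and "odd p" and "[p = 3] (mod 4)"
    and "n > 0" and "odd n"
    and "q = p ^ n" and "N = (p ^ n - 1) div 2"
    and "card (UNIV :: 'a set) = q"
    and "primitive_element \<alpha>" and "\<beta> \<noteq> 0"
    and "\<And>t. m t = field_trace p n (\<beta> * \<alpha> ^ t)"
    and "d = 4"
    and "\<And>i j l t. s i j l t = m (2 * t + i) + m (d * (t + l) + j)"
    and "S = {s i j l | i j l. i \<in> {0, 1} \<and> j \<in> {0, 1} \<and> l \<in> {..<N}}"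
  shows
    "(\<forall>i1\<in>{0, 1}. \<forall>i2\<in>{0, 1}. \<forall>j1\<in>{0, 1}. \<forall>j2\<in>{0, 1}.
      \<forall>l1\<in>{..<N}. \<forall>l2\<in>{..<N}. \<forall>\<tau>\<in>{..<N}.
        s i1 j1 l1 \<in> S \<and> s i2 j2 l2 \<in> S \<and>
        (let a = \<beta> * (\<alpha> ^ i1 - \<alpha> ^ (2 * \<tau> + i2));
             b = \<beta> * (\<alpha> ^ (d * l1 + j1) - \<alpha> ^ (d * \<tau> + d * l2 + j2))
         in correlation p N (s i1 j1 l1) (s i2 j2 l2) \<tau> =
              (\<Sum>t<N. omega_pow p (field_trace p n (a * \<alpha> ^ (2 * t) + b * \<alpha> ^ (4 * t))))))
     \<and> Max {cmod (correlation p N (s i1 j1 l1) (s i2 j2 l2) \<tau>) | i1 i2 j1 j2 l1 l2 \<tau>.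
          i1 \<in> {0, 1} \<and> i2 \<in> {0, 1} \<and> j1 \<in> {0, 1} \<and> j2 \<in> {0, 1} \<and>
          l1 \<in> {..<N} \<and> l2 \<in> {..<N} \<and> \<tau> \<in> {..<N} \<and>
          \<not> (\<tau> = 0 \<and> i1 = i2 \<and> j1 = j2 \<and> l1 = l2)}
        \<le> 3 / sqrt 2 * sqrt (real N + 1 / 2) + 1 / 2"
proof -
  note p = \<open>prime p\<close> and n = \<open>n > 0\<close> and q = \<open>q = p ^ n\<close> and card = \<open>card (UNIV :: 'a set) = q\<close>
    and prim = \<open>primitive_element \<alpha>\<close> and \<beta> = \<open>\<beta> \<noteq> 0\<close> and d = \<open>d = 4\<close>
  have q4: "q mod 4 = 3"
  proof -
    obtain k where k: "n = 2 * k + 1" using \<open>odd n\<close> by (elim oddE)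
    have "[p ^ n = 3 ^ n] (mod 4)" using \<open>[p = 3] (mod 4)\<close> by (rule cong_pow)
    also have "(3::nat) ^ n = 9 ^ k * 3" by (simp add: k power_mult)
    also have "[(9::nat) ^ k * 3 = 1 ^ k * 3] (mod 4)" by (intro cong_mult cong_pow) (auto simp: cong_def)
    finally show ?thesis by (simp add: q cong_def)
  qed
  have N: "q = 2 * N + 1" and N_odd: "odd N"
    using q4 \<open>N = (p ^ n - 1) div 2\<close> unfolding q[symmetric] by presburger+
  have N0: "N > 0" using N_odd by (auto elim: oddE)
  have p2: "p \<noteq> 2" using \<open>odd p\<close> by auto
  define a where "a = (\<lambda>i1 i2 \<tau>. \<beta> * (\<alpha> ^ i1 - \<alpha> ^ (2 * \<tau> + i2)))"
  define b where "b = (\<lambda>j1 j2 l1 l2 \<tau>. \<beta> * (\<alpha> ^ (d * l1 + j1) - \<alpha> ^ (d * \<tau> + d * l2 + j2)))"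
  have corr: "correlation p N (s i1 j1 l1) (s i2 j2 l2) \<tau> =
      (\<Sum>t<N. omega_pow p (field_trace p n (a i1 i2 \<tau> * \<alpha> ^ (2 * t) + b j1 j2 l1 l2 \<tau> * \<alpha> ^ (4 * t))))"
    for i1 i2 j1 j2 l1 l2 \<tau>
  proof -
    have "s i1 j1 l1 t - s i2 j2 l2 (t + \<tau>) =
        field_trace p n (a i1 i2 \<tau> * \<alpha> ^ (2 * t) + b j1 j2 l1 l2 \<tau> * \<alpha> ^ (4 * t))" for t
    proof -
      have "s i1 j1 l1 t - s i2 j2 l2 (t + \<tau>) =
          field_trace p n ((\<beta> * \<alpha> ^ (2 * t + i1) + \<beta> * \<alpha> ^ (d * (t + l1) + j1)) -
            (\<beta> * \<alpha> ^ (2 * (t + \<tau>) + i2) + \<beta> * \<alpha> ^ (d * (t + \<tau> + l2) + j2)))"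
        unfolding assms(11,13) field_trace_add[OF p n q card] field_trace_diff[OF p n q card] ..
      also have "(\<beta> * \<alpha> ^ (2 * t + i1) + \<beta> * \<alpha> ^ (d * (t + l1) + j1)) -
            (\<beta> * \<alpha> ^ (2 * (t + \<tau>) + i2) + \<beta> * \<alpha> ^ (d * (t + \<tau> + l2) + j2)) =
          a i1 i2 \<tau> * \<alpha> ^ (2 * t) + b j1 j2 l1 l2 \<tau> * \<alpha> ^ (4 * t)"
        by (simp add: a_def b_def d algebra_simps power_add)
      finally show ?thesis .
    qed
    then show ?thesis by (simp add: correlation_def)
  qed
  have bound: "cmod (correlation p N (s i1 j1 l1) (s i2 j2 l2) \<tau>) \<le> 3 / sqrt 2 * sqrt (real N + 1 / 2) + 1 / 2"
    if "i1 \<in> {0, 1}" "i2 \<in> {0, 1}" "j1 \<in> {0, 1}" "j2 \<in> {0, 1}" "l1 < N" "l2 < N" "\<tau> < N"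
      "\<not> (\<tau> = 0 \<and> i1 = i2 \<and> j1 = j2 \<and> l1 = l2)" for i1 i2 j1 j2 l1 l2 \<tau>
  proof -
    have "a i1 i2 \<tau> \<noteq> 0 \<or> b j1 j2 l1 l2 \<tau> \<noteq> 0"
    proof (rule ccontr)
      assume "\<not> (a i1 i2 \<tau> \<noteq> 0 \<or> b j1 j2 l1 l2 \<tau> \<noteq> 0)"
      then have ab: "a i1 i2 \<tau> = 0" "b j1 j2 l1 l2 \<tau> = 0" by blast+
      from that(8) show False
        by (rule notE) (rule nontrivial_parameters[OF p n q card prim N N_odd \<beta> that(1-7)
          ab[unfolded a_def b_def d]])
    qed
    then have "cmod (correlation p N (s i1 j1 l1) (s i2 j2 l2) \<tau>) \<le> (3 * sqrt (real q) + 1) / 2"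
      unfolding corr by (rule half_sum_bound[OF p n q card prim N N_odd p2])
    also have "\<dots> = 3 / sqrt 2 * sqrt (real N + 1 / 2) + 1 / 2"
    proof -
      \<comment> \<open>Expressing \<open>sqrt q\<close> through \<open>N\<close> costs a factor
        \<open>sqrt 2\<close>, which turns the constant \<open>3 / 2\<close> into
        \<open>3 / sqrt 2\<close>.\<close>
      have "real N + 1 / 2 = real q / 2" by (simp add: N)
      then have "3 / sqrt 2 * sqrt (real N + 1 / 2) = 3 * sqrt (real q) / (sqrt 2 * sqrt 2)"
        by (simp only: real_sqrt_divide times_divide_times_eq)
      then show ?thesis by (simp add: add_divide_distrib)
    qed
    finally show ?thesis .
  qed
  let ?M = "{cmod (correlation p N (s i1 j1 l1) (s i2 j2 l2) \<tau>) | i1 i2 j1 j2 l1 l2 \<tau>.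
      i1 \<in> {0, 1} \<and> i2 \<in> {0, 1} \<and> j1 \<in> {0, 1} \<and> j2 \<in> {0, 1} \<and>
      l1 \<in> {..<N} \<and> l2 \<in> {..<N} \<and> \<tau> \<in> {..<N} \<and>
      \<not> (\<tau> = 0 \<and> i1 = i2 \<and> j1 = j2 \<and> l1 = l2)}"
  have "?M \<subseteq> (\<lambda>(i1, i2, j1, j2, l1, l2, \<tau>). cmod (correlation p N (s i1 j1 l1) (s i2 j2 l2) \<tau>)) `
      ({0, 1} \<times> {0, 1} \<times> {0, 1} \<times> {0, 1} \<times> {..<N} \<times> {..<N} \<times> {..<N})"
  proof
    fix v assume "v \<in> ?M"
    then obtain i1 i2 j1 j2 l1 l2 \<tau> where "v = cmod (correlation p N (s i1 j1 l1) (s i2 j2 l2) \<tau>)"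
      "i1 \<in> {0, 1}" "i2 \<in> {0, 1}" "j1 \<in> {0, 1}" "j2 \<in> {0, 1}" "l1 \<in> {..<N}" "l2 \<in> {..<N}" "\<tau> \<in> {..<N}"
      by blast
    then show "v \<in> (\<lambda>(i1, i2, j1, j2, l1, l2, \<tau>). cmod (correlation p N (s i1 j1 l1) (s i2 j2 l2) \<tau>)) `
        ({0, 1} \<times> {0, 1} \<times> {0, 1} \<times> {0, 1} \<times> {..<N} \<times> {..<N} \<times> {..<N})"
      by (intro image_eqI[of _ _ "(i1, i2, j1, j2, l1, l2, \<tau>)"]) simp_all
  qed
  then have finM: "finite ?M" by (rule finite_subset) simp
  \<comment> \<open>\<open>Max\<close> is meaningful only on a finite nonempty set;
    \<open>i1 = 0\<close> and \<open>i2 = 1\<close> with all else 0 is a nontrivial choice.\<close>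
  have "cmod (correlation p N (s 0 0 0) (s 1 0 0) 0) \<in> ?M"
    using N0 by (intro CollectI exI[of _ 0] exI[of _ 1]) auto
  then have neM: "?M \<noteq> {}" by blast
  have "Max ?M \<le> 3 / sqrt 2 * sqrt (real N + 1 / 2) + 1 / 2"
    unfolding Max_le_iff[OF finM neM] using bound by blast
  moreover have "s i j l \<in> S" if "i \<in> {0, 1}" "j \<in> {0, 1}" "l \<in> {..<N}" for i j l
    using that unfolding assms(14) by blast
  ultimately show ?thesis
    unfolding Let_def corr a_def b_def by blast
qed

end
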